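(* Let $X$ be a real Banach space admitting a finite-dimensional decomposition (FDD). Then there is a compact, convex, linearly dense subset $K\subset X$ that is a Lipschitz retract of $X$ and such that $\mathrm{Lip}_0(X)$ is linearly isomorphic to $\mathrm{Lip}_0(K)$.
   Context: A finite-dimensional (Schauder) decomposition (FDD) of $X$ is a sequence $(X_n)_{n\in\mathbb{N}}$ of non-trivial finite-dimensional subspaces of $X$ such that every $x\in X$ has a unique representation $x=\sum_n x_n$ (norm-convergent series) with $x_n\in X_n$ for all $n$. A subset $K\subset X$ is linearly dense if its linear span is dense in $X$. $K$ is a Lipschitz retract of $X$ if there is a Lipschitz map $r:X\to K$ with $r(x)=x$ for all $x\in K$. For a metric space $M$ with a chosen base point $0\in M$, $\mathrm{Lip}_0(M)$ is the Banach space of Lipschitz functions $f:M\to\mathbb{R}$ vanishing at the base point, normed by the best Lipschitz constant; up to linear isometry it does not depend on the base point. Subsets of $X$ carry the norm metric. *)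

theory Defs
  imports "HOL-Analysis.Analysis"
begin

definition finite_dim_decomposition :: "(nat \<Rightarrow> 'a::real_normed_vector set) \<Rightarrow> bool" where
  "finite_dim_decomposition E \<longleftrightarrow>
     (\<forall>n. subspace (E n) \<and> E n \<noteq> {0} \<and> (\<exists>B. finite B \<and> span B = E n)) \<and>
     (\<forall>x. \<exists>!u. (\<forall>n. u n \<in> E n) \<and> u sums x)"

definition linearly_dense :: "'a::real_normed_vector set \<Rightarrow> bool" where
  "linearly_dense K \<longleftrightarrow> closure (span K) = UNIV"

definition lipschitz_retract :: "'a::metric_space set \<Rightarrow> bool" where
  "lipschitz_retract K \<longleftrightarrow>
     (\<exists>r :: 'a \<Rightarrow> 'a. (\<exists>L. L-lipschitz_on UNIV r) \<and> range r \<subseteq> K \<and> (\<forall>x\<in>K. r x = x))"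

text \<open>
  A function on \<open>M\<close> is represented by its extension by 0 to the whole type, so that equality of
  functions is equality on \<open>M\<close> and the pointwise operations stay inside \<open>Lip0 M p\<close>.
  The base point \<open>p\<close> is meant to lie in \<open>M\<close>.
\<close>

definition Lip0 :: "'a::metric_space set \<Rightarrow> 'a \<Rightarrow> ('a \<Rightarrow> real) set" where
  "Lip0 M p = {f. (\<exists>L. L-lipschitz_on M f) \<and> f p = 0 \<and> (\<forall>x. x \<notin> M \<longrightarrow> f x = 0)}"

definition lip_norm :: "'a::metric_space set \<Rightarrow> ('a \<Rightarrow> real) \<Rightarrow> real" where
  "lip_norm M f = Inf {L. L-lipschitz_on M f}"

text \<open>Isomorphism of normed spaces: a linear bijection, bounded together with its inverse.\<close>

definition Lip0_isomorphic ::
    "'a::metric_space set \<Rightarrow> 'a \<Rightarrow> 'b::metric_space set \<Rightarrow> 'b \<Rightarrow> bool" where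
  "Lip0_isomorphic M p N q \<longleftrightarrow>
     (\<exists>T. bij_betw T (Lip0 M p) (Lip0 N q) \<and>
        (\<forall>f\<in>Lip0 M p. \<forall>g\<in>Lip0 M p. T (\<lambda>x. f x + g x) = (\<lambda>y. T f y + T g y)) \<and>
        (\<forall>c. \<forall>f\<in>Lip0 M p. T (\<lambda>x. c * f x) = (\<lambda>y. c * T f y)) \<and>
        (\<exists>C. \<forall>f\<in>Lip0 M p. lip_norm N (T f) \<le> C * lip_norm M f) \<and>
        (\<exists>D. \<forall>f\<in>Lip0 M p. lip_norm M f \<le> D * lip_norm N (T f)))"

end

theory Submission
  imports Defs
begin

text \<open>
  Write \<open>x = (\<Sum>k. x\<^sub>k)\<close> for the expansion of \<open>x\<close> in the FDD and let
  \<open>K = {x. (\<Sum>k. 2\<^sup>k \<parallel>x\<^sub>k\<parallel>) \<le> 1}\<close>. By the Baire category theorem the partial sum projections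
  are uniformly bounded. Following the expansion of \<open>x\<close> until the budget 1 is used up, and
  shortening the component where this happens, is a retraction onto \<open>K\<close>; it is Lipschitz because
  the weights grow geometrically, so that only one component is really shortened and what lies
  beyond it is controlled by the budget left.

  For the isomorphism let \<open>A = Lip\<^sub>0 X\<close>, \<open>B = Lip\<^sub>0 K\<close> and \<open>Z\<close> the \<open>\<ell>\<^sub>\<infinity>\<close>-sum of countably many copies of
  \<open>B\<close>. The retraction makes \<open>B\<close> complemented in \<open>A\<close>. The dilations \<open>n K\<close> exhaust a dense
  subset of \<open>X\<close> and are Lipschitz retracts with a common constant, so \<open>A\<close> is complemented in \<open>Z\<close>
  (glue along an ultrafilter). Placing disjoint scaled copies of \<open>K\<close> inside \<open>K\<close> shows that \<open>Z\<close> is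
  complemented in \<open>B\<close>. Since \<open>Z\<close> is isomorphic to its own \<open>\<ell>\<^sub>\<infinity>\<close>-sum, Pelczynski's decomposition
  method gives that \<open>A\<close>, \<open>Z\<close> and \<open>B\<close> are isomorphic.
\<close>

section \<open>Pelczynski's decomposition method\<close>

text \<open>A normed space of functions is encoded by a single relation: \<open>N L f\<close> means that \<open>f\<close> belongs
  to the space and has norm at most \<open>L\<close>.\<close>

type_synonym 'i normed_fun_space = "real \<Rightarrow> ('i \<Rightarrow> real) \<Rightarrow> bool"

definition normed_space :: "'i normed_fun_space \<Rightarrow> bool" where
  "normed_space N \<longleftrightarrow>
     (\<forall>L f. N L f \<longrightarrow> 0 \<le> L) \<and>
     (\<forall>L M f. N L f \<longrightarrow> L \<le> M \<longrightarrow> N M f) \<and>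
     (\<forall>a b L M f g. N L f \<longrightarrow> N M g \<longrightarrow> N (\<bar>a\<bar> * L + \<bar>b\<bar> * M) (\<lambda>i. a * f i + b * g i))"

definition vectors :: "'i normed_fun_space \<Rightarrow> ('i \<Rightarrow> real) set" where
  "vectors N = {f. \<exists>L. N L f}"

text \<open>Operators are total functions, so linearity is imposed only on the vectors of the domain
  space.\<close>

definition bounded_op ::
    "'i normed_fun_space \<Rightarrow> 'j normed_fun_space \<Rightarrow> (('i \<Rightarrow> real) \<Rightarrow> ('j \<Rightarrow> real)) \<Rightarrow> bool" where
  "bounded_op N M T \<longleftrightarrow>
     (\<forall>f\<in>vectors N. \<forall>g\<in>vectors N. \<forall>a b.
        T (\<lambda>i. a * f i + b * g i) = (\<lambda>j. a * T f j + b * T g j)) \<and>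
     (\<exists>C\<ge>0. \<forall>L f. N L f \<longrightarrow> M (C * L) (T f))"

text \<open>A bounded factorisation of the identity: \<open>S\<close> embeds the space and
  \<open>S\<close> after \<open>R\<close> is a bounded projection onto its image. In this form
  transitivity is mere composition.\<close>

definition complemented :: "'i normed_fun_space \<Rightarrow> 'j normed_fun_space \<Rightarrow> bool" where
  "complemented N M \<longleftrightarrow> (\<exists>S R. bounded_op N M S \<and> bounded_op M N R \<and> (\<forall>f\<in>vectors N. R (S f) = f))"

definition isomorphic :: "'i normed_fun_space \<Rightarrow> 'j normed_fun_space \<Rightarrow> bool" where
  "isomorphic N M \<longleftrightarrow> (\<exists>S R. bounded_op N M S \<and> bounded_op M N R \<and>
     (\<forall>f\<in>vectors N. R (S f) = f) \<and> (\<forall>g\<in>vectors M. S (R g) = g))"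

definition linf_sum :: "'i normed_fun_space \<Rightarrow> (nat \<times> 'i) normed_fun_space" where
  "linf_sum N L F \<longleftrightarrow> (\<forall>n. N L (\<lambda>i. F (n, i)))"

definition direct_sum :: "'i normed_fun_space \<Rightarrow> 'j normed_fun_space \<Rightarrow> ('i + 'j) normed_fun_space" where
  "direct_sum N M L F \<longleftrightarrow> N L (\<lambda>i. F (Inl i)) \<and> M L (\<lambda>j. F (Inr j))"

lemma normed_space_nonneg: "normed_space N \<Longrightarrow> N L f \<Longrightarrow> 0 \<le> L"
  and normed_space_mono: "normed_space N \<Longrightarrow> N L f \<Longrightarrow> L \<le> M \<Longrightarrow> N M f"
  and normed_space_lincomb: "normed_space N \<Longrightarrow> N L f \<Longrightarrow> N M g \<Longrightarrow> N (\<bar>a\<bar> * L + \<bar>b\<bar> * M) (\<lambda>i. a * f i + b * g i)"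
  unfolding normed_space_def by blast+

text \<open>The shift operators below have the shape \<open>f - g + h\<close>: a component
  \<open>g\<close> in a complemented subspace is taken out and \<open>h\<close> is put in its place.
  This is their triangle inequality.\<close>

lemma normed_space_exchange:
  assumes "normed_space N" "N L f" "N M g" "N K h"
  shows "N (L + M + K) (\<lambda>i. f i - g i + h i)"
  using normed_space_lincomb[OF assms(1),
      OF normed_space_lincomb[OF assms(1), OF assms(2,3), of 1 "-1"] assms(4), of 1 1]
  by simp

lemma vectorsE:
  assumes "f \<in> vectors N" obtains L where "N L f"
  using assms unfolding vectors_def by blast

lemma vectors_lincomb: "normed_space N \<Longrightarrow> f \<in> vectors N \<Longrightarrow> g \<in> vectors N \<Longrightarrow> (\<lambda>i. a * f i + b * g i) \<in> vectors N"
  unfolding vectors_def using normed_space_lincomb by blast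

lemma bounded_opI:
  assumes "\<And>f g a b. f \<in> vectors N \<Longrightarrow> g \<in> vectors N \<Longrightarrow>
      T (\<lambda>i. a * f i + b * g i) = (\<lambda>j. a * T f j + b * T g j)"
    and "0 \<le> C" "\<And>L f. N L f \<Longrightarrow> M (C * L) (T f)"
  shows "bounded_op N M T"
  using assms unfolding bounded_op_def by blast

lemma bounded_op_lincomb:
  "bounded_op N M T \<Longrightarrow> f \<in> vectors N \<Longrightarrow> g \<in> vectors N \<Longrightarrow>
    T (\<lambda>i. a * f i + b * g i) = (\<lambda>j. a * T f j + b * T g j)"
  unfolding bounded_op_def by blast

lemma bounded_op_bound:
  assumes "bounded_op N M T"
  obtains C where "0 \<le> C" "\<And>L f. N L f \<Longrightarrow> M (C * L) (T f)"
  using assms unfolding bounded_op_def by blast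

lemma bounded_op_vectors: "bounded_op N M T \<Longrightarrow> f \<in> vectors N \<Longrightarrow> T f \<in> vectors M"
  unfolding bounded_op_def vectors_def by blast

lemma bounded_op_exchange:
  assumes "normed_space N" "bounded_op N M T" "f \<in> vectors N" "g \<in> vectors N" "h \<in> vectors N"
  shows "T (\<lambda>i. f i - g i + h i) = (\<lambda>j. T f j - T g j + T h j)"
proof -
  have "(\<lambda>i. f i - g i) \<in> vectors N"
    using vectors_lincomb[OF assms(1,3,4), of 1 "-1"] by simp
  then have "T (\<lambda>i. f i - g i + h i) = (\<lambda>j. T (\<lambda>i. f i - g i) j + T h j)"
    using bounded_op_lincomb[OF assms(2) _ assms(5), of "\<lambda>i. f i - g i" 1 1] by simp
  moreover have "T (\<lambda>i. f i - g i) = (\<lambda>j. T f j - T g j)"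
    using bounded_op_lincomb[OF assms(2,3,4), of 1 "-1"] by simp
  ultimately show ?thesis by simp
qed

lemma bounded_op_comp:
  assumes "bounded_op N M T" "bounded_op M K S"
  shows "bounded_op N K (\<lambda>f. S (T f))"
proof -
  obtain C D where C: "0 \<le> C" "\<And>L f. N L f \<Longrightarrow> M (C * L) (T f)"
    and D: "0 \<le> D" "\<And>L f. M L f \<Longrightarrow> K (D * L) (S f)"
    using bounded_op_bound assms by metis
  show ?thesis
  proof (rule bounded_opI[where C = "D * C"])
    fix f g a b assume "f \<in> vectors N" "g \<in> vectors N"
    then show "S (T (\<lambda>i. a * f i + b * g i)) = (\<lambda>j. a * S (T f) j + b * S (T g) j)"
      using bounded_op_lincomb[OF assms(1)] bounded_op_lincomb[OF assms(2)] bounded_op_vectors[OF assms(1)] by simp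
  next
    show "0 \<le> D * C" using C D by simp
  next
    fix L f assume "N L f"
    then show "K (D * C * L) (S (T f))"
      using C(2) D(2) by (metis mult.assoc)
  qed
qed

lemma isomorphic_sym: "isomorphic N M \<Longrightarrow> isomorphic M N"
  unfolding isomorphic_def by blast

lemma isomorphic_trans:
  assumes "isomorphic N M" "isomorphic M K"
  shows "isomorphic N K"
proof -
  obtain S R where 1: "bounded_op N M S" "bounded_op M N R" "\<forall>f\<in>vectors N. R (S f) = f" "\<forall>g\<in>vectors M. S (R g) = g"
    using assms(1) unfolding isomorphic_def by blast
  obtain S' R' where 2: "bounded_op M K S'" "bounded_op K M R'" "\<forall>f\<in>vectors M. R' (S' f) = f" "\<forall>g\<in>vectors K. S' (R' g) = g"
    using assms(2) unfolding isomorphic_def by blast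
  show ?thesis
    unfolding isomorphic_def
  proof (intro exI conjI ballI)
    show "bounded_op N K (\<lambda>f. S' (S f))" "bounded_op K N (\<lambda>f. R (R' f))"
      using 1 2 bounded_op_comp by blast+
  next
    show "R (R' (S' (S f))) = f" if "f \<in> vectors N" for f
      using 1(3) 2(3) that bounded_op_vectors[OF 1(1)] by simp
  next
    show "S' (S (R (R' g))) = g" if "g \<in> vectors K" for g
      using 1(4) 2(4) that bounded_op_vectors[OF 2(2)] by simp
  qed
qed

lemma complemented_trans:
  assumes "complemented N M" "complemented M K"
  shows "complemented N K"
proof -
  obtain S R where 1: "bounded_op N M S" "bounded_op M N R" "\<forall>f\<in>vectors N. R (S f) = f"
    using assms(1) unfolding complemented_def by blast
  obtain S' R' where 2: "bounded_op M K S'" "bounded_op K M R'" "\<forall>f\<in>vectors M. R' (S' f) = f"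
    using assms(2) unfolding complemented_def by blast
  show ?thesis
    unfolding complemented_def
  proof (intro exI conjI ballI)
    show "bounded_op N K (\<lambda>f. S' (S f))" "bounded_op K N (\<lambda>f. R (R' f))"
      using 1 2 bounded_op_comp by blast+
  next
    show "R (R' (S' (S f))) = f" if "f \<in> vectors N" for f
      using 1(3) 2(3) that bounded_op_vectors[OF 1(1)] by simp
  qed
qed

lemma isomorphic_imp_complemented: "isomorphic N M \<Longrightarrow> complemented N M"
  unfolding isomorphic_def complemented_def by blast

section \<open>Countable sums, direct sums and absorption by shifting\<close>

lemma normed_space_linf_sum: "normed_space N \<Longrightarrow> normed_space (linf_sum N)"
proof -
  assume N: "normed_space N"
  show ?thesis
    unfolding normed_space_def[of "linf_sum N"] linf_sum_def
  proof (intro conjI allI impI)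
    show "0 \<le> L" if "\<forall>n. N L (\<lambda>i. F (n, i))" for L F
      using normed_space_nonneg[OF N] that by blast
    show "N M (\<lambda>i. F (n, i))" if "\<forall>n. N L (\<lambda>i. F (n, i))" "L \<le> M" for L M F n
      using normed_space_mono[OF N] that by blast
    show "N (\<bar>a\<bar> * L + \<bar>b\<bar> * M) (\<lambda>i. a * F (n, i) + b * G (n, i))"
      if "\<forall>n. N L (\<lambda>i. F (n, i))" "\<forall>n. N M (\<lambda>i. G (n, i))" for a b L M F G n
      using normed_space_lincomb[OF N, OF spec[OF that(1)] spec[OF that(2)]] .
  qed
qed

lemma linf_sum_nth: "linf_sum N L F \<Longrightarrow> N L (\<lambda>i. F (n, i))"
  by (simp add: linf_sum_def)

lemma vectors_linf_sum_nth: "F \<in> vectors (linf_sum N) \<Longrightarrow> (\<lambda>i. F (n, i)) \<in> vectors N"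
  unfolding vectors_def linf_sum_def by blast

lemma vectors_direct_sum:
  assumes "F \<in> vectors (direct_sum N M)"
  shows "(\<lambda>i. F (Inl i)) \<in> vectors N" "(\<lambda>j. F (Inr j)) \<in> vectors M"
  using assms unfolding vectors_def direct_sum_def by blast+

lemma isomorphic_direct_sum_commute: "isomorphic (direct_sum N M) (direct_sum M N)"
proof -
  have *: "bounded_op (direct_sum A B) (direct_sum B A) (\<lambda>F. case_sum (\<lambda>i. F (Inr i)) (\<lambda>j. F (Inl j)))"
    for A :: "'x normed_fun_space" and B :: "'y normed_fun_space"
    by (rule bounded_opI[where C = 1]) (auto simp: direct_sum_def fun_eq_iff split: sum.splits)
  show ?thesis
    unfolding isomorphic_def
    by (intro exI conjI, rule *, rule *) (auto simp: fun_eq_iff split: sum.splits)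
qed

text \<open>Pure reindexing along the bijection between pairs of naturals and naturals, isometric in
  both directions.\<close>

lemma isomorphic_linf_sum_linf_sum: "isomorphic (linf_sum (linf_sum N)) (linf_sum N)"
proof -
  let ?S = "\<lambda>F (k, i). F (fst (prod_decode k), snd (prod_decode k), i)"
  let ?R = "\<lambda>G (n, m, i). G (prod_encode (n, m), i)"
  have "bounded_op (linf_sum (linf_sum N)) (linf_sum N) ?S" "bounded_op (linf_sum N) (linf_sum (linf_sum N)) ?R"
    by (rule bounded_opI[where C = 1]; auto simp: linf_sum_def fun_eq_iff)+
  moreover have "?R (?S F) = F" "?S (?R G) = G" for F G
    by (auto simp: fun_eq_iff)
  ultimately show ?thesis
    unfolding isomorphic_def by blast
qed

text \<open>If \<open>M = N \<oplus> ker R\<close>, then shifting the \<open>N\<close>-components of a sequence in \<open>M\<close> by one place splits off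
  the first of them.\<close>

lemma linf_sum_absorbs_complemented:
  assumes N: "normed_space N" and M: "normed_space M" and c: "complemented N M"
  shows "isomorphic (linf_sum M) (direct_sum N (linf_sum M))"
proof -
  obtain S R where S: "bounded_op N M S" and R: "bounded_op M N R" and RS: "\<And>f. f \<in> vectors N \<Longrightarrow> R (S f) = f"
    using c unfolding complemented_def by blast
  have SR: "bounded_op M M (\<lambda>f. S (R f))"
    by (rule bounded_op_comp[OF R S])
  obtain s where s: "0 \<le> s" "\<And>L f. N L f \<Longrightarrow> M (s * L) (S f)" using bounded_op_bound[OF S] by blast
  obtain r where r: "0 \<le> r" "\<And>L f. M L f \<Longrightarrow> N (r * L) (R f)" using bounded_op_bound[OF R] by blast
  \<comment> \<open>The component \<open>S (R f)\<close> of each entry gives way to that of the next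
    entry; the component of entry 0 is split off as the first summand.\<close>
  define T :: "(nat \<times> 'b \<Rightarrow> real) \<Rightarrow> ('a + nat \<times> 'b \<Rightarrow> real)" where
    "T = (\<lambda>F. case_sum (R (\<lambda>i. F (0, i)))
       (\<lambda>(n, j). F (n, j) - S (R (\<lambda>i. F (n, i))) j + S (R (\<lambda>i. F (Suc n, i))) j))"
  \<comment> \<open>\<open>head G n\<close> is what the inverse must insert at place
    \<open>n\<close>: the split-off vector at 0, and the component of entry \<open>n - 1\<close>
    further on.\<close>
  define head :: "('a + nat \<times> 'b \<Rightarrow> real) \<Rightarrow> nat \<Rightarrow> ('a \<Rightarrow> real)" where
    "head = (\<lambda>G n. case n of 0 \<Rightarrow> (\<lambda>i. G (Inl i)) | Suc m \<Rightarrow> R (\<lambda>i. G (Inr (m, i))))"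
  define U :: "('a + nat \<times> 'b \<Rightarrow> real) \<Rightarrow> (nat \<times> 'b \<Rightarrow> real)" where
    "U = (\<lambda>G (n, j). G (Inr (n, j)) - S (R (\<lambda>i. G (Inr (n, i)))) j + S (head G n) j)"
  have T_linear: "T (\<lambda>p. a * F p + b * G p) = (\<lambda>q. a * T F q + b * T G q)"
    if "F \<in> vectors (linf_sum M)" "G \<in> vectors (linf_sum M)" for F G a b
    unfolding T_def
    using bounded_op_lincomb[OF R vectors_linf_sum_nth[OF that(1)] vectors_linf_sum_nth[OF that(2)]]
      bounded_op_lincomb[OF SR vectors_linf_sum_nth[OF that(1)] vectors_linf_sum_nth[OF that(2)]]
    by (auto simp: fun_eq_iff algebra_simps split: sum.splits)
  have T_bound: "direct_sum N (linf_sum M) ((r + (1 + s * r + s * r)) * L) (T F)" if "linf_sum M L F" for L F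
  proof -
    have L: "0 \<le> L" using linf_sum_nth[OF that] normed_space_nonneg[OF M] by blast
    have "N (r * L) (R (\<lambda>i. F (0, i)))"
      using r(2) linf_sum_nth[OF that] by blast
    then have 1: "N ((r + (1 + s * r + s * r)) * L) (R (\<lambda>i. F (0, i)))"
      by (rule normed_space_mono[OF N]) (use L r(1) s(1) in \<open>simp add: distrib_right\<close>)
    have "M (L + s * (r * L) + s * (r * L))
        (\<lambda>j. F (n, j) - S (R (\<lambda>i. F (n, i))) j + S (R (\<lambda>i. F (Suc n, i))) j)" for n
      by (intro normed_space_exchange[OF M] s(2) r(2) linf_sum_nth[OF that])
    then have 2: "M ((r + (1 + s * r + s * r)) * L)
        (\<lambda>j. F (n, j) - S (R (\<lambda>i. F (n, i))) j + S (R (\<lambda>i. F (Suc n, i))) j)" for n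
      by (rule normed_space_mono[OF M]) (use L r(1) s(1) in \<open>simp add: distrib_right\<close>)
    show ?thesis
      using 1 2 unfolding direct_sum_def linf_sum_def T_def by simp
  qed
  have head_lincomb: "S (head (\<lambda>p. a * F p + b * G p) n) = (\<lambda>q. a * S (head F n) q + b * S (head G n) q)"
    if "F \<in> vectors (direct_sum N (linf_sum M))" "G \<in> vectors (direct_sum N (linf_sum M))" for F G a b n
  proof (cases n)
    case 0
    then show ?thesis
      using bounded_op_lincomb[OF S vectors_direct_sum(1)[OF that(1)] vectors_direct_sum(1)[OF that(2)]]
      by (simp add: head_def)
  next
    case (Suc m)
    then show ?thesis
      using bounded_op_lincomb[OF SR vectors_linf_sum_nth[OF vectors_direct_sum(2)[OF that(1)]]
          vectors_linf_sum_nth[OF vectors_direct_sum(2)[OF that(2)]]]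
      by (simp add: head_def)
  qed
  have U_linear: "U (\<lambda>p. a * F p + b * G p) = (\<lambda>q. a * U F q + b * U G q)"
    if "F \<in> vectors (direct_sum N (linf_sum M))" "G \<in> vectors (direct_sum N (linf_sum M))" for F G a b
    unfolding U_def
    using head_lincomb[OF that] bounded_op_lincomb[OF SR vectors_linf_sum_nth[OF vectors_direct_sum(2)[OF that(1)]]
          vectors_linf_sum_nth[OF vectors_direct_sum(2)[OF that(2)]]]
    by (auto simp: fun_eq_iff algebra_simps)
  have head_vectors: "head G n \<in> vectors N" if "G \<in> vectors (direct_sum N (linf_sum M))" for G n
    using vectors_direct_sum[OF that] vectors_linf_sum_nth[OF vectors_direct_sum(2)[OF that]] bounded_op_vectors[OF R]
    by (cases n) (auto simp: head_def)
  have U_bound: "linf_sum M ((1 + s * r + s * (1 + r)) * L) (U G)" if "direct_sum N (linf_sum M) L G" for L G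
  proof -
    have G: "N L (\<lambda>i. G (Inl i))" "\<And>n. M L (\<lambda>j. G (Inr (n, j)))"
      using that unfolding direct_sum_def linf_sum_def by blast+
    have L: "0 \<le> L" using G(1) normed_space_nonneg[OF N] by blast
    have "N ((1 + r) * L) (head G n)" for n
    proof (cases n)
      case 0
      then show ?thesis
        using normed_space_mono[OF N, OF G(1), of "(1 + r) * L"] L r(1) by (simp add: head_def distrib_right)
    next
      case (Suc m)
      then show ?thesis
        using normed_space_mono[OF N, OF r(2)[OF G(2)], of "(1 + r) * L"] L by (simp add: head_def distrib_right)
    qed
    then have "M (L + s * (r * L) + s * ((1 + r) * L))
        (\<lambda>j. G (Inr (n, j)) - S (R (\<lambda>i. G (Inr (n, i)))) j + S (head G n) j)" for n
      by (intro normed_space_exchange[OF M] s(2) r(2) G)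
    then show ?thesis
      unfolding linf_sum_def U_def by (simp add: algebra_simps)
  qed
  have UT: "U (T F) = F" if F: "F \<in> vectors (linf_sum M)" for F
  proof -
    note Fn = vectors_linf_sum_nth[OF F]
    \<comment> \<open>\<open>R\<close> annihilates \<open>f - S (R f)\<close>, because
      \<open>R\<close> after \<open>S\<close> is the identity, so it sees only the inserted
      component.\<close>
    have RT: "R (\<lambda>j. T F (Inr (n, j))) = R (\<lambda>i. F (Suc n, i))" for n
    proof -
      have "R (\<lambda>j. T F (Inr (n, j))) = (\<lambda>j. R (\<lambda>i. F (n, i)) j - R (S (R (\<lambda>i. F (n, i)))) j
          + R (S (R (\<lambda>i. F (Suc n, i)))) j)"
        using bounded_op_exchange[OF M R Fn[of n] bounded_op_vectors[OF SR Fn[of n]] bounded_op_vectors[OF SR Fn[of "Suc n"]]]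
        by (simp add: T_def)
      then show ?thesis
        using RS[OF bounded_op_vectors[OF R Fn]] by simp
    qed
    have "head (T F) n = R (\<lambda>i. F (n, i))" for n
      by (cases n) (simp_all add: head_def RT, simp add: T_def)
    then have "U (T F) (n, j) = F (n, j)" for n j
      unfolding U_def prod.case RT by (simp add: T_def)
    then show ?thesis by auto
  qed
  have TU: "T (U G) = G" if G: "G \<in> vectors (direct_sum N (linf_sum M))" for G
  proof -
    note Gn = vectors_linf_sum_nth[OF vectors_direct_sum(2)[OF G]] and hd = head_vectors[OF G]
    have RU: "R (\<lambda>j. U G (n, j)) = head G n" for n
    proof -
      have "R (\<lambda>j. U G (n, j)) = (\<lambda>j. R (\<lambda>i. G (Inr (n, i))) j - R (S (R (\<lambda>i. G (Inr (n, i))))) j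
          + R (S (head G n)) j)"
        using bounded_op_exchange[OF M R Gn[of n] bounded_op_vectors[OF SR Gn[of n]] bounded_op_vectors[OF S hd[of n]]]
        by (simp add: U_def)
      then show ?thesis
        using RS[OF bounded_op_vectors[OF R Gn]] RS[OF hd] by simp
    qed
    have "T (U G) (Inl i) = G (Inl i)" for i
      by (simp add: T_def RU) (simp add: head_def)
    moreover have "T (U G) (Inr (n, j)) = G (Inr (n, j))" for n j
      by (simp add: T_def RU) (simp add: U_def head_def)
    ultimately show ?thesis
      by (metis (no_types, lifting) ext old.sum.exhaust surj_pair)
  qed
  have "bounded_op (linf_sum M) (direct_sum N (linf_sum M)) T"
    using T_linear T_bound r(1) s(1)
    by (intro bounded_opI[where C = "r + (1 + s * r + s * r)"]) simp_all
  moreover have "bounded_op (direct_sum N (linf_sum M)) (linf_sum M) U"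
    using U_linear U_bound r(1) s(1)
    by (intro bounded_opI[where C = "1 + s * r + s * (1 + r)"]) simp_all
  ultimately show ?thesis
    unfolding isomorphic_def using UT TU by blast
qed

text \<open>The same shift, applied to the complemented sequence space inside \<open>A\<close>.\<close>

lemma absorbs_if_linf_sum_complemented:
  assumes N: "normed_space N" and A: "normed_space A" and c: "complemented (linf_sum N) A"
  shows "isomorphic A (direct_sum N A)"
proof -
  obtain S R where S: "bounded_op (linf_sum N) A S" and R: "bounded_op A (linf_sum N) R"
    and RS: "\<And>F. F \<in> vectors (linf_sum N) \<Longrightarrow> R (S F) = F"
    using c unfolding complemented_def by blast
  have SR: "bounded_op A A (\<lambda>f. S (R f))"
    by (rule bounded_op_comp[OF R S])
  \<comment> \<open>Left shift of a sequence, and its one-sided inverse that puts the first summand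
    of \<open>G\<close> in front.\<close>
  let ?shift = "\<lambda>F (n, i). F (Suc n, i)"
  let ?cons = "\<lambda>G F (n, i). case n of 0 \<Rightarrow> G (Inl i) | Suc m \<Rightarrow> F (m, i)"
  let ?hd = "\<lambda>F i. F (0, i)"
  let ?inr = "\<lambda>G j. G (Inr j)"
  have hd: "bounded_op (linf_sum N) N ?hd"
    by (rule bounded_opI[where C = 1]) (auto simp: linf_sum_def)
  have shift: "bounded_op (linf_sum N) (linf_sum N) ?shift"
    by (rule bounded_opI[where C = 1]) (auto simp: linf_sum_def fun_eq_iff)
  have inr: "bounded_op (direct_sum N A) A ?inr"
    by (rule bounded_opI[where C = 1]) (auto simp: direct_sum_def)
  have cons: "bounded_op (direct_sum N A) (linf_sum N) (\<lambda>G. ?cons G (R (?inr G)))"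
  proof -
    obtain r where r: "0 \<le> r" "\<And>L f. A L f \<Longrightarrow> linf_sum N (r * L) (R f)" using bounded_op_bound[OF R] by blast
    show ?thesis
    proof (rule bounded_opI[where C = "1 + r"])
      fix f g :: "'a + 'b \<Rightarrow> real" and a b
      assume fg: "f \<in> vectors (direct_sum N A)" "g \<in> vectors (direct_sum N A)"
      show "?cons (\<lambda>i. a * f i + b * g i) (R (?inr (\<lambda>i. a * f i + b * g i))) =
          (\<lambda>j. a * ?cons f (R (?inr f)) j + b * ?cons g (R (?inr g)) j)"
        using bounded_op_lincomb[OF R vectors_direct_sum(2)[OF fg(1)] vectors_direct_sum(2)[OF fg(2)]]
        by (auto simp: fun_eq_iff split: nat.splits)
    next
      fix L f assume f: "direct_sum N A L f"
      then have 1: "N L (\<lambda>i. f (Inl i))" and 2: "linf_sum N (r * L) (R (?inr f))"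
        using r(2) by (auto simp: direct_sum_def)
      have L: "0 \<le> L" using 1 normed_space_nonneg[OF N] by blast
      have "N ((1 + r) * L) (\<lambda>i. ?cons f (R (?inr f)) (n, i))" for n
      proof (cases n)
        case 0
        then show ?thesis using normed_space_mono[OF N, OF 1, of "(1 + r) * L"] L r(1) by (simp add: distrib_right)
      next
        case (Suc m)
        then show ?thesis
          using normed_space_mono[OF N, OF linf_sum_nth[OF 2], of "(1 + r) * L"] L by (simp add: distrib_right)
      qed
      then show "linf_sum N ((1 + r) * L) (?cons f (R (?inr f)))" unfolding linf_sum_def by simp
    qed (use r in simp)
  qed
  have exch: "bounded_op P A (\<lambda>f j. X f j - Y f j + Z f j)"
    if t: "bounded_op P A X" "bounded_op P A Y" "bounded_op P A Z" for P :: "'z normed_fun_space" and X Y Z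
  proof -
    obtain x where x: "0 \<le> x" "\<And>L f. P L f \<Longrightarrow> A (x * L) (X f)"
      using bounded_op_bound[OF t(1)] by blast
    obtain y where y: "0 \<le> y" "\<And>L f. P L f \<Longrightarrow> A (y * L) (Y f)"
      using bounded_op_bound[OF t(2)] by blast
    obtain z where z: "0 \<le> z" "\<And>L f. P L f \<Longrightarrow> A (z * L) (Z f)"
      using bounded_op_bound[OF t(3)] by blast
    show ?thesis
    proof (rule bounded_opI[where C = "x + y + z"])
      fix f g a b assume fg: "f \<in> vectors P" "g \<in> vectors P"
      show "(\<lambda>j. X (\<lambda>i. a * f i + b * g i) j - Y (\<lambda>i. a * f i + b * g i) j + Z (\<lambda>i. a * f i + b * g i) j)
        = (\<lambda>j. a * (X f j - Y f j + Z f j) + b * (X g j - Y g j + Z g j))"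
        using bounded_op_lincomb[OF t(1) fg] bounded_op_lincomb[OF t(2) fg] bounded_op_lincomb[OF t(3) fg]
        by (simp add: algebra_simps)
    next
      fix L f assume "P L f"
      then show "A ((x + y + z) * L) (\<lambda>j. X f j - Y f j + Z f j)"
        using normed_space_exchange[OF A, OF x(2) y(2) z(2)] by (simp add: distrib_right)
    qed (use x y z in simp)
  qed
  have I: "bounded_op A A (\<lambda>f. f)"
    by (rule bounded_opI[where C = 1]) auto
  \<comment> \<open>\<open>S (R f)\<close> is the part of \<open>f\<close> in the copy of
    \<open>linf_sum N\<close>. It is replaced by its left shift; the entry lost in doing so becomes
    the first half of \<open>?T\<close>.\<close>
  let ?T2 = "\<lambda>f j. f j - S (R f) j + S (?shift (R f)) j"
  let ?T = "\<lambda>f. case_sum (?hd (R f)) (?T2 f)"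
  let ?U = "\<lambda>G j. G (Inr j) - S (R (?inr G)) j + S (?cons G (R (?inr G))) j"
  have U: "bounded_op (direct_sum N A) A ?U"
    by (rule exch[OF inr bounded_op_comp[OF inr SR] bounded_op_comp[OF cons S]])
  have T2: "bounded_op A A ?T2"
    by (rule exch[OF I SR bounded_op_comp[OF bounded_op_comp[OF R shift] S]])
  have T1: "bounded_op A N (\<lambda>f. ?hd (R f))"
    by (rule bounded_op_comp[OF R hd])
  have T: "bounded_op A (direct_sum N A) ?T"
  proof -
    obtain x where x: "0 \<le> x" "\<And>L f. A L f \<Longrightarrow> N (x * L) (?hd (R f))"
      using bounded_op_bound[OF T1] by blast
    obtain y where y: "0 \<le> y" "\<And>L f. A L f \<Longrightarrow> A (y * L) (?T2 f)"
      using bounded_op_bound[OF T2] by blast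
    show ?thesis
    proof (rule bounded_opI[where C = "x + y"])
      fix f g a b assume "f \<in> vectors A" "g \<in> vectors A"
      from bounded_op_lincomb[OF T1 this] bounded_op_lincomb[OF T2 this]
      show "?T (\<lambda>i. a * f i + b * g i) = (\<lambda>j. a * ?T f j + b * ?T g j)"
        by (auto simp: fun_eq_iff split: sum.splits)
    next
      fix L f assume f: "A L f"
      then have L: "0 \<le> L" using normed_space_nonneg[OF A] by blast
      show "direct_sum N A ((x + y) * L) (?T f)"
        using normed_space_mono[OF N, OF x(2)[OF f], of "(x + y) * L"] normed_space_mono[OF A, OF y(2)[OF f], of "(x + y) * L"] L x(1) y(1)
        unfolding direct_sum_def by (simp add: distrib_right)
    qed (use x y in simp)
  qed
  have UT: "?U (?T f) = f" if f: "f \<in> vectors A" for f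
  proof -
    note c1 = bounded_op_vectors[OF R f]
    note c2 = bounded_op_vectors[OF shift c1]
    have "R (?T2 f) = (\<lambda>j. R f j - R (S (R f)) j + R (S (?shift (R f))) j)"
      by (rule bounded_op_exchange[OF A R f bounded_op_vectors[OF S c1] bounded_op_vectors[OF S c2]])
    also have "\<dots> = ?shift (R f)"
      using RS[OF c1] RS[OF c2] by simp
    finally have *: "R (?inr (?T f)) = ?shift (R f)" by simp
    have "?cons (?T f) (?shift (R f)) = R f"
      by (auto simp: fun_eq_iff split: nat.splits)
    then show ?thesis unfolding * by simp
  qed
  have TU: "?T (?U G) = G" if G: "G \<in> vectors (direct_sum N A)" for G
  proof -
    note g = bounded_op_vectors[OF inr G]
    note c1 = bounded_op_vectors[OF R g] and c2 = bounded_op_vectors[OF cons G]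
    have "R (?U G) = (\<lambda>j. R (?inr G) j - R (S (R (?inr G))) j + R (S (?cons G (R (?inr G)))) j)"
      by (rule bounded_op_exchange[OF A R g bounded_op_vectors[OF S c1] bounded_op_vectors[OF S c2]])
    also have "\<dots> = ?cons G (R (?inr G))"
      using RS[OF c1] RS[OF c2] by simp
    finally have *: "R (?U G) = ?cons G (R (?inr G))" .
    have **: "?shift (?cons G (R (?inr G))) = R (?inr G)" by (auto simp: fun_eq_iff)
    show ?thesis
      unfolding * ** by (auto simp: fun_eq_iff split: sum.splits)
  qed
  show ?thesis
    unfolding isomorphic_def using T U UT TU by blast
qed

text \<open>With \<open>?Z\<close> the iterated sum, each of \<open>A\<close> and \<open>?Z\<close>
  absorbs the other, so \<open>A\<close> is isomorphic to \<open>?Z + A\<close>, to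
  \<open>A + ?Z\<close> and hence to \<open>?Z\<close>.\<close>

theorem pelczynski_decomposition:
  assumes A: "normed_space A" and B: "normed_space B"
    and 1: "complemented (linf_sum B) A" and 2: "complemented A (linf_sum B)"
  shows "isomorphic A (linf_sum B)"
proof -
  \<comment> \<open>Iterating the sum gives \<open>?Z\<close> the shape \<open>linf_sum M\<close>
    with \<open>A\<close> complemented in \<open>M = linf_sum B\<close>, which is what absorbing
    \<open>A\<close> asks for.\<close>
  let ?Z = "linf_sum (linf_sum B)"
  have Z: "isomorphic ?Z (linf_sum B)" and ZZ: "isomorphic (linf_sum ?Z) ?Z"
    by (rule isomorphic_linf_sum_linf_sum)+
  have "complemented (linf_sum ?Z) A"
    by (rule complemented_trans[OF isomorphic_imp_complemented[OF isomorphic_trans[OF ZZ Z]] 1])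
  then have "isomorphic A (direct_sum ?Z A)"
    by (intro absorbs_if_linf_sum_complemented normed_space_linf_sum A B)
  then have "isomorphic A (direct_sum A ?Z)"
    by (rule isomorphic_trans[OF _ isomorphic_direct_sum_commute])
  moreover have "isomorphic ?Z (direct_sum A ?Z)"
    by (intro linf_sum_absorbs_complemented normed_space_linf_sum A B 2)
  ultimately show ?thesis
    by (rule isomorphic_trans[OF _ isomorphic_trans[OF isomorphic_sym Z]])
qed

section \<open>Complemented subspaces of Lipschitz function spaces\<close>

lemma ultrafilter_exists:
  assumes "F \<noteq> bot"
  shows "\<exists>U\<le>F. U \<noteq> bot \<and> (\<forall>P. eventually P U \<or> eventually (\<lambda>x. \<not> P x) U)"
proof -
  let ?A = "{G. G \<le> F \<and> G \<noteq> bot}"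
  have "\<exists>U\<in>?A. \<forall>G\<in>?A. G \<le> U \<longrightarrow> G = U"
  proof (rule predicate_Zorn)
    show "partial_order_on ?A (relation_of (\<lambda>a b. b \<le> a) ?A)"
      by (rule partial_order_on_relation_ofI) auto
  next
    fix C assume C: "C \<in> Chains (relation_of (\<lambda>a b. b \<le> a) ?A)"
    have sub: "C \<subseteq> ?A" and lin: "\<And>G H. G \<in> C \<Longrightarrow> H \<in> C \<Longrightarrow> G \<le> H \<or> H \<le> G"
      using C unfolding Chains_def relation_of_def by blast+
    show "\<exists>u\<in>?A. \<forall>a\<in>C. u \<le> a"
    proof (cases "C = {}")
      case True
      then show ?thesis using assms by blast
    next
      case False
      \<comment> \<open>A chain is directed, so what holds eventually in its infimum holds
        eventually in one member; hence the infimum stays proper.\<close>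
      have "\<not> eventually (\<lambda>_. False) (Inf C)"
      proof (subst eventually_Inf_base[OF False])
        show "\<exists>x\<in>C. x \<le> inf G H" if "G \<in> C" "H \<in> C" for G H
          using lin[OF that] that by auto
        show "\<not> (\<exists>b\<in>C. eventually (\<lambda>_. False) b)"
          using sub by (auto simp: trivial_limit_def)
      qed
      then have "Inf C \<noteq> bot" by auto
      moreover have "Inf C \<le> F"
      proof -
        obtain G where "G \<in> C" using False by blast
        then show ?thesis using sub by (intro Inf_lower2[of G]) auto
      qed
      ultimately show ?thesis by (intro bexI[of _ "Inf C"]) (auto intro: Inf_lower)
    qed
  qed
  then obtain U where UA: "U \<in> ?A" "\<forall>G\<in>?A. G \<le> U \<longrightarrow> G = U" by blast
  then have U: "U \<le> F" "U \<noteq> bot" by auto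
  have min: "G = U" if "G \<le> U" "G \<noteq> bot" for G
    using UA that order_trans[OF that(1) U(1)] by blast
  \<comment> \<open>Restricting a minimal proper filter to \<open>{x. P x}\<close> either makes it
    improper or leaves it unchanged, so every predicate is decided.\<close>
  have "eventually P U \<or> eventually (\<lambda>x. \<not> P x) U" for P
  proof (rule disjCI)
    assume "\<not> eventually (\<lambda>x. \<not> P x) U"
    then have "inf U (principal {x. P x}) \<noteq> bot"
      by (auto simp: trivial_limit_def eventually_inf_principal)
    then have "inf U (principal {x. P x}) = U" by (intro min) auto
    moreover have "eventually P (inf U (principal {x. P x}))"
      by (simp add: eventually_inf_principal)
    ultimately show "eventually P U" by simp
  qed
  with U show ?thesis by blast
qed

text \<open>Compactness of the interval yields a cluster point of the image filter. Since the
  ultrafilter decides each neighbourhood, a cluster point is already a limit.\<close>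

lemma ultrafilter_convergent:
  fixes f :: "'a \<Rightarrow> real"
  assumes "U \<noteq> bot" "\<And>P. eventually P U \<or> eventually (\<lambda>x. \<not> P x) U" "\<And>x. \<bar>f x\<bar> \<le> B"
  shows "\<exists>l. (f \<longlongrightarrow> l) U"
proof -
  have "filtermap f U \<noteq> bot" using assms(1) by (simp add: filtermap_bot_iff)
  moreover have "eventually (\<lambda>x. x \<in> {-B..B}) (filtermap f U)"
    using assms(3) by (auto simp: eventually_filtermap abs_le_iff minus_le_iff)
  ultimately obtain l where l: "inf (nhds l) (filtermap f U) \<noteq> bot"
    using compact_filter[of "{-B..B}"] by blast
  have "filtermap f U \<le> nhds l"
  proof (rule filter_leI, rule ccontr)
    fix P assume P: "eventually P (nhds l)" "\<not> eventually P (filtermap f U)"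
    then have "eventually (\<lambda>x. \<not> P x) (filtermap f U)"
      using assms(2)[of "\<lambda>x. P (f x)"] by (simp add: eventually_filtermap)
    with P(1) have "eventually (\<lambda>_. False) (inf (nhds l) (filtermap f U))"
      unfolding eventually_inf by blast
    with l show False by (simp add: trivial_limit_def)
  qed
  then show ?thesis unfolding filterlim_def by blast
qed

section \<open>Lipschitz functions as a normed space of functions\<close>

definition lip_space :: "'a::metric_space set \<Rightarrow> 'a \<Rightarrow> 'a normed_fun_space" where
  "lip_space M p L f \<longleftrightarrow> L-lipschitz_on M f \<and> f p = 0 \<and> (\<forall>x. x \<notin> M \<longrightarrow> f x = 0)"

lemma lip_spaceI:
  assumes "0 \<le> L" "\<And>x y. x \<in> M \<Longrightarrow> y \<in> M \<Longrightarrow> \<bar>f x - f y\<bar> \<le> L * dist x y"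
    "f p = 0" "\<And>x. x \<notin> M \<Longrightarrow> f x = 0"
  shows "lip_space M p L f"
  using assms unfolding lip_space_def by (auto intro!: lipschitz_onI simp: dist_real_def)

lemma lip_spaceD:
  assumes "lip_space M p L f"
  shows "0 \<le> L" "x \<in> M \<Longrightarrow> y \<in> M \<Longrightarrow> \<bar>f x - f y\<bar> \<le> L * dist x y" "f p = 0" "x \<notin> M \<Longrightarrow> f x = 0"
  using assms unfolding lip_space_def lipschitz_on_def by (auto simp: dist_real_def)

lemma vectors_lip_space: "vectors (lip_space M p) = Lip0 M p"
  unfolding vectors_def lip_space_def Lip0_def by auto

lemma normed_space_lip_space: "normed_space (lip_space M p)"
  unfolding normed_space_def
proof (intro conjI allI impI)
  show "0 \<le> L" if "lip_space M p L f" for L f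
    using lip_spaceD(1)[OF that] .
  show "lip_space M p L' f" if "lip_space M p L f" "L \<le> L'" for L L' f
    using that lipschitz_on_le unfolding lip_space_def by blast
  show "lip_space M p (\<bar>a\<bar> * L + \<bar>b\<bar> * L') (\<lambda>i. a * f i + b * g i)"
    if f: "lip_space M p L f" and g: "lip_space M p L' g" for a b L L' f g
  proof (rule lip_spaceI)
    fix x y assume xy: "x \<in> M" "y \<in> M"
    have "\<bar>a * f x + b * g x - (a * f y + b * g y)\<bar> = \<bar>a * (f x - f y) + b * (g x - g y)\<bar>"
      by (simp add: algebra_simps)
    also have "\<dots> \<le> \<bar>a\<bar> * \<bar>f x - f y\<bar> + \<bar>b\<bar> * \<bar>g x - g y\<bar>"
      by (metis abs_mult abs_triangle_ineq)
    also have "\<dots> \<le> \<bar>a\<bar> * (L * dist x y) + \<bar>b\<bar> * (L' * dist x y)"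
      by (intro add_mono mult_left_mono lip_spaceD(2)[OF f xy] lip_spaceD(2)[OF g xy]) auto
    finally show "\<bar>a * f x + b * g x - (a * f y + b * g y)\<bar> \<le> (\<bar>a\<bar> * L + \<bar>b\<bar> * L') * dist x y"
      by (simp add: algebra_simps)
  qed (use lip_spaceD[OF f] lip_spaceD[OF g] in auto)
qed

lemma lip_norm_le:
  assumes "L-lipschitz_on M f" shows "lip_norm M f \<le> L"
  unfolding lip_norm_def
  by (rule cInf_lower) (use assms lipschitz_on_nonneg in \<open>auto intro!: bdd_belowI[of _ 0]\<close>)

text \<open>The infimum is attained: each difference quotient is a lower bound for all Lipschitz
  constants, hence at most their infimum.\<close>

lemma lipschitz_on_lip_norm:
  assumes "L-lipschitz_on M f" shows "(lip_norm M f)-lipschitz_on M f"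
proof (rule lipschitz_onI)
  let ?S = "{L. L-lipschitz_on M f}"
  have ne: "?S \<noteq> {}" using assms by blast
  then show "0 \<le> lip_norm M f"
    unfolding lip_norm_def by (rule cInf_greatest) (use lipschitz_on_nonneg in auto)
  fix x y assume xy: "x \<in> M" "y \<in> M"
  show "dist (f x) (f y) \<le> lip_norm M f * dist x y"
  proof (cases "x = y")
    case False
    then have "dist (f x) (f y) / dist x y \<le> lip_norm M f"
      unfolding lip_norm_def
      by (intro cInf_greatest[OF ne]) (use xy lipschitz_onD in \<open>auto simp: divide_le_eq\<close>)
    with False show ?thesis by (simp add: divide_le_eq)
  qed simp
qed

text \<open>Bounds by arbitrary Lipschitz constants become bounds for \<open>lip_norm\<close> by
  inserting the attained best constant.\<close>

lemma isomorphic_lip_space_imp: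
  assumes "isomorphic (lip_space M p) (lip_space N q)"
  shows "Lip0_isomorphic M p N q"
proof -
  \<comment> \<open>Stated for arbitrary spaces so that it serves both \<open>T\<close> and its
    inverse; the latter yields the lower bound.\<close>
  have bd: "\<exists>C. \<forall>f\<in>Lip0 M p. lip_norm N (T f) \<le> C * lip_norm M f"
    if T: "bounded_op (lip_space M p) (lip_space N q) T" for T
      and M :: "'c::metric_space set" and N :: "'d::metric_space set" and p q
  proof -
    obtain C where C: "\<And>L f. lip_space M p L f \<Longrightarrow> lip_space N q (C * L) (T f)"
      using bounded_op_bound[OF T] by blast
    have "lip_norm N (T f) \<le> C * lip_norm M f" if "f \<in> Lip0 M p" for f
    proof -
      have "lip_space M p (lip_norm M f) f"
        using that lipschitz_on_lip_norm unfolding Lip0_def lip_space_def by blast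
      from C[OF this] show ?thesis
        unfolding lip_space_def by (blast intro: lip_norm_le)
    qed
    then show ?thesis by blast
  qed
  obtain T T' where T: "bounded_op (lip_space M p) (lip_space N q) T" and T': "bounded_op (lip_space N q) (lip_space M p) T'"
    and inv: "\<And>f. f \<in> Lip0 M p \<Longrightarrow> T' (T f) = f" "\<And>g. g \<in> Lip0 N q \<Longrightarrow> T (T' g) = g"
    using assms unfolding isomorphic_def vectors_lip_space by blast
  have maps: "\<And>f. f \<in> Lip0 M p \<Longrightarrow> T f \<in> Lip0 N q" "\<And>g. g \<in> Lip0 N q \<Longrightarrow> T' g \<in> Lip0 M p"
    using bounded_op_vectors[OF T] bounded_op_vectors[OF T'] unfolding vectors_lip_space by auto
  have "bij_betw T (Lip0 M p) (Lip0 N q)"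
    by (rule bij_betw_byWitness[where f' = T']) (use inv maps in auto)
  moreover have "T (\<lambda>x. f x + g x) = (\<lambda>y. T f y + T g y)" if "f \<in> Lip0 M p" "g \<in> Lip0 M p" for f g
    using bounded_op_lincomb[OF T, of f g 1 1] that unfolding vectors_lip_space by simp
  moreover have "T (\<lambda>x. c * f x) = (\<lambda>y. c * T f y)" if "f \<in> Lip0 M p" for f c
    using bounded_op_lincomb[OF T, of f f c 0] that unfolding vectors_lip_space by simp
  moreover have "\<exists>D. \<forall>f\<in>Lip0 M p. lip_norm M f \<le> D * lip_norm N (T f)"
  proof -
    obtain D where "\<forall>g\<in>Lip0 N q. lip_norm M (T' g) \<le> D * lip_norm N g"
      using bd[OF T'] by blast
    then show ?thesis using maps inv by metis
  qed
  ultimately show ?thesis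
    unfolding Lip0_isomorphic_def using bd[OF T] by blast
qed

text \<open>Subtracting the value at the new base point leaves all differences unchanged, so the
  change of base point is isometric.\<close>

lemma isomorphic_lip_space_base:
  assumes "p \<in> M" "q \<in> M"
  shows "isomorphic (lip_space M p) (lip_space M q)"
proof -
  let ?S = "\<lambda>q f x. if x \<in> M then f x - f q else (0::real)"
  have S: "bounded_op (lip_space M p) (lip_space M q) (?S q)" if "q \<in> M" for p q
  proof (rule bounded_opI[where C = 1])
    show "lip_space M q (1 * L) (?S q f)" if "lip_space M p L f" for L f
      by (rule lip_spaceI) (use lip_spaceD[OF that] in auto)
  qed (auto simp: fun_eq_iff algebra_simps)
  show ?thesis
    unfolding isomorphic_def vectors_lip_space
    by (intro exI conjI, rule S, fact, rule S, fact) (use assms in \<open>auto simp: Lip0_def fun_eq_iff\<close>)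
qed

section \<open>The complementations linking the whole space, the retract and the countable
  sum\<close>

lemma dist_scaleR_cancel: "dist (c *\<^sub>R x) (c *\<^sub>R y) = \<bar>c\<bar> * dist x y"
  for x y :: "'a::real_normed_vector"
  by (simp add: dist_norm flip: scaleR_diff_right)

text \<open>Composition with \<open>r\<close> is a bounded linear extension operator, and
  restriction to \<open>K\<close> is a left inverse of it.\<close>

lemma complemented_lip_space_retract:
  assumes r: "C-lipschitz_on UNIV r" "range r \<subseteq> K" "\<And>x. x \<in> K \<Longrightarrow> r x = x" and p: "p \<in> K"
  shows "complemented (lip_space K p) (lip_space UNIV p)"
proof -
  have C: "0 \<le> C" using r(1) lipschitz_on_nonneg by blast
  have "bounded_op (lip_space K p) (lip_space UNIV p) (\<lambda>f x. f (r x))"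
  proof (rule bounded_opI[OF _ C])
    fix L f assume f: "lip_space K p L f"
    show "lip_space UNIV p (C * L) (\<lambda>x. f (r x))"
    proof (rule lip_spaceI)
      fix x y
      have "\<bar>f (r x) - f (r y)\<bar> \<le> L * dist (r x) (r y)"
        using lip_spaceD(2)[OF f] r(2) by blast
      also have "\<dots> \<le> L * (C * dist x y)"
        using lip_spaceD(1)[OF f] lipschitz_onD[OF r(1)] by (intro mult_left_mono) auto
      finally show "\<bar>f (r x) - f (r y)\<bar> \<le> C * L * dist x y" by (simp add: mult_ac)
    qed (use C lip_spaceD[OF f] r(3)[OF p] in auto)
  qed simp
  moreover have "bounded_op (lip_space UNIV p) (lip_space K p) (\<lambda>g x. if x \<in> K then g x else 0)"
  proof (rule bounded_opI[where C = 1])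
    show "lip_space K p (1 * L) (\<lambda>x. if x \<in> K then f x else 0)" if "lip_space UNIV p L f" for L f
      by (rule lip_spaceI) (use lip_spaceD[OF that] in auto)
  qed (auto simp: fun_eq_iff)
  moreover have "(\<lambda>x. if x \<in> K then f (r x) else 0) = f" if "f \<in> vectors (lip_space K p)" for f
    using that r(3) unfolding vectors_lip_space Lip0_def by (auto simp: fun_eq_iff)
  ultimately show ?thesis
    unfolding complemented_def by blast
qed

text \<open>The dilations of \<open>K\<close> exhaust a dense set, so the conjugates of \<open>r\<close> by dilations tend
  pointwise to the identity, and any limit of \<open>s\<^sub>n g\<^sub>n (r (x / s\<^sub>n))\<close> along an ultrafilter recovers
  a Lipschitz function from its rescaled restrictions to \<open>K\<close>.\<close>

lemma complemented_lip_space_UNIV: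
  fixes K :: "'a::real_normed_vector set"
  assumes r: "C-lipschitz_on UNIV r" "range r \<subseteq> K" "\<And>x. x \<in> K \<Longrightarrow> r x = x"
    and K: "convex K" "0 \<in> K" and dense: "closure (cone hull K) = UNIV"
  shows "complemented (lip_space (UNIV :: 'a set) 0) (linf_sum (lip_space K 0))"
proof -
  have C: "0 \<le> C" using r(1) lipschitz_on_nonneg by blast
  have rK: "r x \<in> K" for x using r(2) by blast
  obtain U :: "nat filter" where U: "U \<le> sequentially" "U \<noteq> bot"
    and ultra: "\<And>P. eventually P U \<or> eventually (\<lambda>x. \<not> P x) U"
    using ultrafilter_exists[OF sequentially_bot] by blast
  define s :: "nat \<Rightarrow> real" where "s = (\<lambda>n. real (Suc n))"
  have s: "0 < s n" for n by (simp add: s_def)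
  \<comment> \<open>The conjugate of \<open>r\<close> by a dilation retracts onto \<open>s n\<close>
    times \<open>K\<close> with the same constant \<open>C\<close>.\<close>
  define \<rho> where "\<rho> = (\<lambda>n x. s n *\<^sub>R r (x /\<^sub>R s n))"
  have \<rho>_lip: "dist (\<rho> n x) (\<rho> n y) \<le> C * dist x y" for n x y
  proof -
    have "dist (\<rho> n x) (\<rho> n y) = s n * dist (r (x /\<^sub>R s n)) (r (y /\<^sub>R s n))"
      using s[of n] by (simp add: \<rho>_def dist_scaleR_cancel)
    also have "\<dots> \<le> s n * (C * dist (x /\<^sub>R s n) (y /\<^sub>R s n))"
      using s[of n] lipschitz_onD[OF r(1)] by (intro mult_left_mono) auto
    also have "dist (x /\<^sub>R s n) (y /\<^sub>R s n) = dist x y / s n"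
      using s[of n] by (simp add: dist_scaleR_cancel divide_inverse mult.commute)
    finally show ?thesis using s[of n] by simp
  qed
  have \<rho>_tendsto: "(\<lambda>n. \<rho> n x) \<longlonglongrightarrow> x" for x
  proof (rule metric_LIMSEQ_I)
    fix e :: real assume "0 < e"
    \<comment> \<open>For large \<open>n\<close> the map \<open>\<rho> n\<close> fixes a point
      \<open>y\<close> closer than \<open>d\<close> to \<open>x\<close>, so its error at
      \<open>x\<close> is below \<open>C * d + d = e\<close>.\<close>
    define d where "d = e / (1 + C)"
    have d: "0 < d" "d * (1 + C) = e" using \<open>0 < e\<close> C by (auto simp: d_def)
    have "x \<in> closure (cone hull K)" using dense by simp
    then obtain y where y: "y \<in> cone hull K" "dist y x < d"
      using d(1) closure_approachable by blast
    then obtain c z where cz: "y = c *\<^sub>R z" "0 \<le> c" "z \<in> K"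
      unfolding cone_hull_expl by blast
    obtain m where m: "c \<le> real m" using real_arch_simple by blast
    have "dist (\<rho> n x) x < e" if "m \<le> n" for n
    proof -
      \<comment> \<open>Convexity and \<open>0 \<in> K\<close> allow shrinking inside
        \<open>K\<close>, so \<open>y = c z\<close> lies in \<open>s n\<close> times
        \<open>K\<close> once \<open>c \<le> s n\<close>.\<close>
      have le: "c / s n \<le> 1" "0 \<le> c / s n" using m that cz(2) by (auto simp: s_def)
      have "(c / s n) *\<^sub>R z + (1 - c / s n) *\<^sub>R 0 \<in> K"
        using le by (intro convexD[OF K(1) cz(3) K(2)]) auto
      then have "y /\<^sub>R s n \<in> K" using cz(1) by (simp add: divide_inverse mult.commute)
      then have "\<rho> n y = y" using s[of n] r(3) by (simp add: \<rho>_def)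
      then have "dist (\<rho> n x) x \<le> C * dist x y + dist y x"
        using \<rho>_lip[of n x y] dist_triangle[of "\<rho> n x" x y] by simp
      also have "\<dots> = dist y x * (1 + C)" by (simp add: dist_commute algebra_simps)
      also have "\<dots> < d * (1 + C)" using y(2) C by (intro mult_strict_right_mono) auto
      finally show ?thesis using d(2) by simp
    qed
    then show "\<exists>m. \<forall>n\<ge>m. dist (\<rho> n x) x < e" by blast
  qed
  define t where "t = (\<lambda>G x n. s n * G (n, r (x /\<^sub>R s n)) :: real)"
  define R where "R = (\<lambda>G x. Lim U (t G x))"
  \<comment> \<open>The dilation factors cancel, so the bound does not depend on \<open>n\<close>.
    It makes the sequence bounded, so that the limit exists, and it passes to that limit.\<close>
  have t_lip: "\<bar>t G x n - t G y n\<bar> \<le> C * L * dist x y" and t0: "t G 0 n = 0"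
    if G: "linf_sum (lip_space K 0) L G" for G L x y n
  proof -
    have Gn: "lip_space K 0 L (\<lambda>x. G (n, x))" using linf_sum_nth[OF G] .
    have "\<bar>t G x n - t G y n\<bar> = s n * \<bar>G (n, r (x /\<^sub>R s n)) - G (n, r (y /\<^sub>R s n))\<bar>"
      using s[of n] by (simp add: t_def abs_mult flip: right_diff_distrib)
    also have "\<dots> \<le> s n * (L * dist (r (x /\<^sub>R s n)) (r (y /\<^sub>R s n)))"
      using s[of n] lip_spaceD(2)[OF Gn rK rK] by (intro mult_left_mono) auto
    also have "\<dots> = L * dist (\<rho> n x) (\<rho> n y)"
      using s[of n] by (simp add: \<rho>_def dist_scaleR_cancel)
    also have "\<dots> \<le> L * (C * dist x y)"
      by (rule mult_left_mono[OF \<rho>_lip lip_spaceD(1)[OF Gn]])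
    finally show "\<bar>t G x n - t G y n\<bar> \<le> C * L * dist x y" by (simp add: mult_ac)
    show "t G 0 n = 0" using lip_spaceD(3)[OF Gn] r(3)[OF K(2)] by (simp add: t_def)
  qed
  have t_lim: "(t G x \<longlongrightarrow> R G x) U" if G: "G \<in> vectors (linf_sum (lip_space K 0))" for G x
  proof -
    obtain L where L: "linf_sum (lip_space K 0) L G" using G by (rule vectorsE)
    have "\<bar>t G x n\<bar> \<le> C * L * dist x 0" for n
      using t_lip[OF L, of x n 0] t0[OF L] by simp
    then obtain l where "(t G x \<longlongrightarrow> l) U"
      using ultrafilter_convergent[OF U(2) ultra] by blast
    then show ?thesis unfolding R_def using tendsto_Lim[OF U(2)] by metis
  qed
  have R: "bounded_op (linf_sum (lip_space K 0)) (lip_space UNIV 0) R"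
  proof (rule bounded_opI[OF _ C])
    fix F G a b assume FG: "F \<in> vectors (linf_sum (lip_space K 0))" "G \<in> vectors (linf_sum (lip_space K 0))"
    show "R (\<lambda>i. a * F i + b * G i) = (\<lambda>x. a * R F x + b * R G x)"
    proof
      fix x
      have "((\<lambda>n. a * t F x n + b * t G x n) \<longlongrightarrow> a * R F x + b * R G x) U"
        by (intro tendsto_intros t_lim FG)
      moreover have "(\<lambda>n. a * t F x n + b * t G x n) = t (\<lambda>i. a * F i + b * G i) x"
        by (simp add: t_def algebra_simps)
      ultimately show "R (\<lambda>i. a * F i + b * G i) x = a * R F x + b * R G x"
        unfolding R_def using tendsto_Lim[OF U(2)] by metis
    qed
  next
    fix L G assume G: "linf_sum (lip_space K 0) L G"
    have "G \<in> vectors (linf_sum (lip_space K 0))" using G unfolding vectors_def by blast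
    note lim = t_lim[OF this]
    show "lip_space UNIV 0 (C * L) (R G)"
    proof (rule lip_spaceI)
      show "0 \<le> C * L" using C lip_spaceD(1)[OF linf_sum_nth[OF G]] by simp
      fix x y
      have "((\<lambda>n. \<bar>t G x n - t G y n\<bar>) \<longlongrightarrow> \<bar>R G x - R G y\<bar>) U"
        by (intro tendsto_intros lim)
      then show "\<bar>R G x - R G y\<bar> \<le> C * L * dist x y"
        by (rule tendsto_upperbound) (use t_lip[OF G] U(2) in auto)
    next
      have "t G 0 = (\<lambda>n. 0)" using t0[OF G] by auto
      then show "R G 0 = 0" using lim[of 0] tendsto_unique[OF U(2) _ tendsto_const] by metis
    qed auto
  qed
  \<comment> \<open>Dividing by \<open>s n\<close> undoes the dilation, so all entries share the
    Lipschitz constant of \<open>f\<close>.\<close>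
  define S where "S = (\<lambda>f (n, x). if x \<in> K then f (s n *\<^sub>R x) / s n else (0::real))"
  have S: "bounded_op (lip_space UNIV 0) (linf_sum (lip_space K 0)) S"
  proof (rule bounded_opI[where C = 1])
    fix L and f :: "'a \<Rightarrow> real" assume f: "lip_space UNIV 0 L f"
    have "lip_space K 0 L (\<lambda>x. if x \<in> K then f (s n *\<^sub>R x) / s n else 0)" for n
    proof (rule lip_spaceI)
      fix x y assume xy: "x \<in> K" "y \<in> K"
      have "\<bar>f (s n *\<^sub>R x) - f (s n *\<^sub>R y)\<bar> \<le> L * dist (s n *\<^sub>R x) (s n *\<^sub>R y)"
        by (rule lip_spaceD(2)[OF f]) auto
      also have "\<dots> = L * dist x y * s n" using s[of n] by (simp add: dist_scaleR_cancel)
      finally have "\<bar>f (s n *\<^sub>R x) - f (s n *\<^sub>R y)\<bar> / s n \<le> L * dist x y"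
        using s[of n] by (simp add: divide_le_eq)
      then show "\<bar>(if x \<in> K then f (s n *\<^sub>R x) / s n else 0) - (if y \<in> K then f (s n *\<^sub>R y) / s n else 0)\<bar>
          \<le> L * dist x y"
        using xy s[of n] by (simp add: abs_divide flip: diff_divide_distrib)
    qed (use lip_spaceD[OF f] in auto)
    then show "linf_sum (lip_space K 0) (1 * L) (S f)" unfolding linf_sum_def S_def by simp
  qed (auto simp: S_def fun_eq_iff add_divide_distrib)
  have "R (S f) = f" if f: "f \<in> vectors (lip_space UNIV 0)" for f
  proof
    fix x
    obtain L where "lip_space UNIV 0 L f" using f by (rule vectorsE)
    then have "isCont f x"
      unfolding lip_space_def using lipschitz_on_continuous_within by blast
    then have "(\<lambda>n. f (\<rho> n x)) \<longlonglongrightarrow> f x"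
      using \<rho>_tendsto isCont_tendsto_compose by blast
    \<comment> \<open>On the range of \<open>S\<close> the sequence converges to \<open>f x\<close>
      in the ordinary sense, and \<open>U\<close> refines \<open>sequentially\<close>.\<close>
    moreover have "(\<lambda>n. f (\<rho> n x)) = t (S f) x"
      using s rK by (auto simp: t_def S_def \<rho>_def less_imp_neq[THEN not_sym] fun_eq_iff)
    ultimately have "(t (S f) x \<longlongrightarrow> f x) U"
      using U(1) tendsto_mono by metis
    then show "R (S f) x = f x"
      unfolding R_def using tendsto_Lim[OF U(2)] by blast
  qed
  with R S show ?thesis
    unfolding complemented_def by (intro exI[of _ S] exI[of _ R]) simp
qed

text \<open>The cutoff is \<open>1 / D\<close>-Lipschitz and vanishes outside the ball of radius
  \<open>2 * D\<close>, where \<open>G\<close> is at most \<open>2 * D * M\<close>. The product rule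
  gives \<open>M + (1 / D) * (2 * D * M) = 3 * M\<close>.\<close>

lemma bump_product_lipschitz:
  fixes G :: "'a::real_normed_vector \<Rightarrow> real"
  assumes D: "0 < D" and G: "\<And>u v. \<bar>G u - G v\<bar> \<le> M * dist u v" "G 0 = 0"
  defines "\<phi> \<equiv> \<lambda>u. max 0 (min 1 (2 - norm u / D))"
  shows "\<bar>\<phi> u * G u - \<phi> v * G v\<bar> \<le> 3 * M * dist u v"
proof -
  have \<phi>: "0 \<le> \<phi> u" "\<phi> u \<le> 1" "2 * D < norm u \<Longrightarrow> \<phi> u = 0" for u
    using D by (auto simp: \<phi>_def divide_simps)
  have \<phi>_lip: "\<bar>\<phi> u - \<phi> v\<bar> \<le> dist u v / D" for u v
  proof -
    have "\<bar>\<phi> u - \<phi> v\<bar> \<le> \<bar>norm u / D - norm v / D\<bar>" unfolding \<phi>_def by linarith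
    also have "\<dots> = \<bar>norm u - norm v\<bar> / D" using D by (simp flip: diff_divide_distrib)
    also have "\<dots> \<le> dist u v / D"
      using D norm_triangle_ineq3[of u v] by (simp add: dist_norm divide_right_mono)
    finally show ?thesis .
  qed
  \<comment> \<open>The increment of the cutoff is multiplied by \<open>G v\<close>, so only
    \<open>v\<close> has to lie in the ball. Swapping the points covers the case of \<open>u\<close>
    in the ball; with both outside, the product vanishes at both.\<close>
  have *: "\<bar>\<phi> u * G u - \<phi> v * G v\<bar> \<le> 3 * M * dist u v" if v: "norm v \<le> 2 * D" for u v
  proof -
    have M: "0 \<le> M * dist u v" using G(1)[of u v] by linarith
    have Gv: "\<bar>G v\<bar> \<le> M * norm v" using G(1)[of v 0] G(2) by (simp add: dist_norm)
    have "\<bar>\<phi> u * G u - \<phi> v * G v\<bar> = \<bar>\<phi> u * (G u - G v) + (\<phi> u - \<phi> v) * G v\<bar>"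
      by (simp add: algebra_simps)
    also have "\<dots> \<le> \<phi> u * \<bar>G u - G v\<bar> + \<bar>\<phi> u - \<phi> v\<bar> * \<bar>G v\<bar>"
      using \<phi>(1)[of u] abs_triangle_ineq[of "\<phi> u * (G u - G v)" "(\<phi> u - \<phi> v) * G v"]
      by (simp add: abs_mult)
    also have "\<dots> \<le> 1 * (M * dist u v) + (dist u v / D) * (M * norm v)"
      using \<phi>(2)[of u] D by (intro add_mono mult_mono G(1) \<phi>_lip Gv) auto
    also have "(dist u v / D) * (M * norm v) = (M * dist u v) * (norm v / D)" by simp
    also have "\<dots> \<le> (M * dist u v) * 2"
      using v D by (intro mult_left_mono M) (simp add: divide_le_eq)
    finally show ?thesis by simp
  qed
  show ?thesis
  proof (cases "norm v \<le> 2 * D")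
    case True
    then show ?thesis by (rule *)
  next
    case v: False
    show ?thesis
    proof (cases "norm u \<le> 2 * D")
      case True
      then show ?thesis using *[of u v] by (simp add: abs_minus_commute dist_commute)
    next
      case False
      then show ?thesis using v \<phi>(3) G(1)[of u v] by simp
    qed
  qed
qed

text \<open>The \<open>j\<close>-th copy of \<open>K\<close> is placed at \<open>2\<^sup>-\<^sup>j (e\<^sub>0 + \<delta> K)\<close>, inside the annulus
  \<open>3/4 \<parallel>e\<^sub>0\<parallel> < 2\<^sup>j \<parallel>y\<parallel> < 5/4 \<parallel>e\<^sub>0\<parallel>\<close>. These annuli are disjoint, so at most one summand of the
  glued function is nonzero at a given point.\<close>

lemma complemented_linf_sum_lip_space:
  fixes K :: "'a::real_normed_vector set"
  assumes r: "C-lipschitz_on UNIV r" "range r \<subseteq> K" "\<And>x. x \<in> K \<Longrightarrow> r x = x"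
    and K: "convex K" "bounded K" "0 \<in> K" "K \<noteq> {0}"
  shows "complemented (linf_sum (lip_space K 0)) (lip_space K 0)"
proof -
  have C: "0 \<le> C" using r(1) lipschitz_on_nonneg by blast
  have rK: "r x \<in> K" for x using r(2) by blast
  have shrink: "t *\<^sub>R x \<in> K" if "x \<in> K" "0 \<le> t" "t \<le> 1" for t x
    using convexD[OF K(1) that(1) K(3), of t "1 - t"] that by simp
  obtain D where D: "0 < D" "\<And>x. x \<in> K \<Longrightarrow> norm x \<le> D"
    using K(2) bounded_pos by metis
  obtain e where e: "e \<in> K" "e \<noteq> 0" using K(3,4) by blast
  \<comment> \<open>Half of \<open>e\<close>, so that \<open>e0 + \<delta> x\<close> is the midpoint
    of \<open>e\<close> and \<open>2 \<delta> x\<close>, both in \<open>K\<close> when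
    \<open>\<delta> \<le> 1/2\<close>.\<close>
  define e0 where "e0 = (1/2) *\<^sub>R e"
  define \<eta> where "\<eta> = norm e0"
  have \<eta>: "0 < \<eta>" using e(2) by (simp add: \<eta>_def e0_def)
  \<comment> \<open>The second bound keeps the cutoff region, a ball of radius
    \<open>2 * D * \<delta> \<le> \<eta> / 4\<close> around \<open>e0\<close> after rescaling,
    inside the annulus.\<close>
  define \<delta> where "\<delta> = min (1/2) (\<eta> / (8 * D))"
  have \<delta>: "0 < \<delta>" "\<delta> \<le> 1/2" "\<delta> * D \<le> \<eta> / 8"
    using \<eta> D(1) by (auto simp: \<delta>_def min_def divide_simps)
  define p where "p = (\<lambda>(j::nat) x. (1 / 2 ^ j) *\<^sub>R (e0 + \<delta> *\<^sub>R x))"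
  define q where "q = (\<lambda>(j::nat) y. (1 / \<delta>) *\<^sub>R ((2 ^ j) *\<^sub>R y - e0))"
  have pK: "p j x \<in> K" if "x \<in> K" for j x
  proof -
    have "(1/2) *\<^sub>R e + (1/2) *\<^sub>R ((2 * \<delta>) *\<^sub>R x) \<in> K"
      using \<delta> by (intro convexD[OF K(1) e(1)] shrink that) auto
    then have "e0 + \<delta> *\<^sub>R x \<in> K" by (simp add: e0_def)
    then show ?thesis unfolding p_def by (rule shrink) auto
  qed
  have qp: "q j (p j x) = x" for j x
    using \<delta>(1) by (simp add: q_def p_def)
  have p_dist: "dist (p j x) (p j y) = \<delta> / 2 ^ j * dist x y" for j x y
    using \<delta>(1) by (simp add: p_def dist_scaleR_cancel)
  have q_dist: "dist (q j x) (q j y) = 2 ^ j / \<delta> * dist x y" for j x y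
  proof -
    have "dist (2 ^ j *\<^sub>R x - e0) (2 ^ j *\<^sub>R y - e0) = dist ((2 ^ j) *\<^sub>R x) ((2 ^ j) *\<^sub>R y)"
      by (simp add: dist_norm)
    then show ?thesis using \<delta>(1) by (simp add: q_def dist_scaleR_cancel)
  qed
  define active where "active = (\<lambda>(y::'a) (j::nat). 3/4 * \<eta> < 2 ^ j * norm y \<and> 2 ^ j * norm y < 5/4 * \<eta>)"
  \<comment> \<open>Raising the index at least doubles the scaled norm, from above
    \<open>3/4 \<eta>\<close> to above \<open>3/2 \<eta>\<close>, which exceeds
    \<open>5/4 \<eta>\<close>.\<close>
  have active_less: "\<not> i < k" if "active y i" "active y k" for y i k
  proof
    assume "i < k"
    then have "(2::real) ^ Suc i \<le> 2 ^ k" by (intro power_increasing) auto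
    then have "2 ^ Suc i * norm y \<le> 2 ^ k * norm y" by (intro mult_right_mono) auto
    then have "2 * (2 ^ i * norm y) \<le> 2 ^ k * norm y" by simp
    then show False using that \<eta> unfolding active_def by linarith
  qed
  \<comment> \<open>The choice is arbitrary at points in no annulus; there every
    \<open>F g j\<close> vanishes.\<close>
  define J where "J = (\<lambda>y. SOME j. active y j)"
  have J: "J y = j" if "active y j" for y j
    using active_less[OF that] active_less[OF _ that] someI[of "active y", OF that]
    unfolding J_def by (meson linorder_neqE_nat)
  have near: "active y j" if "norm (q j y) < 2 * D" for y j
  proof -
    have "norm ((2 ^ j) *\<^sub>R y - e0) < 2 * D * \<delta>"
      using that \<delta>(1) by (simp add: q_def divide_less_eq)
    also have "\<dots> \<le> \<eta> / 4" using \<delta>(3) by (simp add: mult_ac)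
    finally have "norm ((2 ^ j) *\<^sub>R y - e0) < \<eta> / 4" .
    moreover have "\<bar>norm ((2 ^ j) *\<^sub>R y) - \<eta>\<bar> \<le> norm ((2 ^ j) *\<^sub>R y - e0)"
      unfolding \<eta>_def by (rule norm_triangle_ineq3)
    ultimately show ?thesis unfolding active_def norm_scaleR by auto
  qed
  define \<phi> where "\<phi> = (\<lambda>u::'a. max 0 (min 1 (2 - norm u / D)))"
  have \<phi>_one: "\<phi> u = 1" if "norm u \<le> D" for u
    using that D(1) by (auto simp: \<phi>_def divide_simps)
  have \<phi>_zero: "\<phi> u = 0" if "\<not> norm u < 2 * D" for u
    using that D(1) by (auto simp: \<phi>_def divide_simps)
  \<comment> \<open>The factor \<open>\<delta> / 2 ^ j\<close> compensates the dilation by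
    \<open>q j\<close>; composing with \<open>r\<close> extends the \<open>j\<close>-th function
    beyond the copy of \<open>K\<close> before it is cut off.\<close>
  define F where "F = (\<lambda>g (j::nat) y. \<delta> / 2 ^ j * (\<phi> (q j y) * g (j, r (q j y))) :: real)"
  have F_zero: "F g j y = 0" if "\<not> active y j" for g j y
    using that near \<phi>_zero unfolding F_def by force
  have F_lip: "\<bar>F g j x - F g j y\<bar> \<le> 3 * (C * L) * dist x y" if g: "linf_sum (lip_space K 0) L g" for g j x y L
  proof -
    have gj: "lip_space K 0 L (\<lambda>x. g (j, x))" using linf_sum_nth[OF g] .
    have 1: "\<bar>g (j, r u) - g (j, r v)\<bar> \<le> C * L * dist u v" for u v
    proof -
      have "\<bar>g (j, r u) - g (j, r v)\<bar> \<le> L * dist (r u) (r v)"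
        by (rule lip_spaceD(2)[OF gj rK rK])
      also have "\<dots> \<le> L * (C * dist u v)"
        using lip_spaceD(1)[OF gj] lipschitz_onD[OF r(1)] by (intro mult_left_mono) auto
      finally show ?thesis by (simp add: mult_ac)
    qed
    have 2: "g (j, r 0) = 0" using lip_spaceD(3)[OF gj] r(3)[OF K(3)] by simp
    have "\<bar>F g j x - F g j y\<bar> = \<delta> / 2 ^ j * \<bar>\<phi> (q j x) * g (j, r (q j x)) - \<phi> (q j y) * g (j, r (q j y))\<bar>"
      unfolding F_def right_diff_distrib[symmetric] abs_mult using \<delta>(1) by simp
    also have "\<dots> \<le> \<delta> / 2 ^ j * (3 * (C * L) * dist (q j x) (q j y))"
      unfolding \<phi>_def
      using \<delta>(1) by (intro mult_left_mono bump_product_lipschitz[where G = "\<lambda>u. g (j, r u)"] D(1) 1 2) auto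
    also have "\<dots> = 3 * (C * L) * dist x y"
      using \<delta>(1) by (simp add: q_dist)
    finally show ?thesis .
  qed
  define S where "S = (\<lambda>g y. if y \<in> K then F g (J y) y else 0)"
  have S: "bounded_op (linf_sum (lip_space K 0)) (lip_space K 0) S"
  \<comment> \<open>Each summand has constant \<open>3 * C * L\<close>. Points with different
    indices need two summands, each vanishing at the other point, hence the factor 6.\<close>
  proof (rule bounded_opI[where C = "6 * C"])
    fix g L assume g: "linf_sum (lip_space K 0) L g"
    have L: "0 \<le> L" using lip_spaceD(1)[OF linf_sum_nth[OF g]] .
    show "lip_space K 0 (6 * C * L) (S g)"
    proof (rule lip_spaceI)
      fix x y assume xy: "x \<in> K" "y \<in> K"
      show "\<bar>S g x - S g y\<bar> \<le> 6 * C * L * dist x y"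
      proof (cases "J x = J y")
        case True
        have "0 \<le> C * L * dist x y" using C L by simp
        with F_lip[OF g, of "J x" x y] True xy show ?thesis by (simp add: S_def)
      next
        case False
        then have "F g (J x) y = 0" "F g (J y) x = 0" using F_zero J by metis+
        with F_lip[OF g, of "J x" x y] F_lip[OF g, of "J y" x y] xy show ?thesis
          by (simp add: S_def)
      qed
    next
      show "S g 0 = 0" using F_zero[of 0] \<eta> by (simp add: S_def active_def)
    qed (use C L in \<open>auto simp: S_def\<close>)
  qed (use C in \<open>auto simp: S_def F_def fun_eq_iff algebra_simps add_divide_distrib\<close>)
  \<comment> \<open>Subtracting \<open>f (p j 0)\<close> restores the base point condition.\<close>
  define R where "R = (\<lambda>f (j, x). if x \<in> K then 2 ^ j / \<delta> * (f (p j x) - f (p j 0)) else (0::real))"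
  have R: "bounded_op (lip_space K 0) (linf_sum (lip_space K 0)) R"
  proof (rule bounded_opI[where C = 1])
    fix L f assume f: "lip_space K 0 L f"
    have "lip_space K 0 L (\<lambda>x. if x \<in> K then 2 ^ j / \<delta> * (f (p j x) - f (p j 0)) else 0)" for j
    proof (rule lip_spaceI)
      fix x y assume xy: "x \<in> K" "y \<in> K"
      have "\<bar>f (p j x) - f (p j y)\<bar> \<le> L * (\<delta> / 2 ^ j * dist x y)"
        using lip_spaceD(2)[OF f pK[OF xy(1)] pK[OF xy(2)], of j j] by (simp add: p_dist)
      then have "2 ^ j / \<delta> * \<bar>f (p j x) - f (p j y)\<bar> \<le> 2 ^ j / \<delta> * (L * (\<delta> / 2 ^ j * dist x y))"
        using \<delta>(1) by (intro mult_left_mono) auto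
      also have "\<dots> = L * dist x y" using \<delta>(1) by simp
      also have "2 ^ j / \<delta> * \<bar>f (p j x) - f (p j y)\<bar> =
          \<bar>2 ^ j / \<delta> * (f (p j x) - f (p j 0)) - 2 ^ j / \<delta> * (f (p j y) - f (p j 0))\<bar>"
        unfolding right_diff_distrib[symmetric] abs_mult using \<delta>(1) by simp
      finally show "\<bar>(if x \<in> K then 2 ^ j / \<delta> * (f (p j x) - f (p j 0)) else 0) -
          (if y \<in> K then 2 ^ j / \<delta> * (f (p j y) - f (p j 0)) else 0)\<bar> \<le> L * dist x y"
        using xy by simp
    qed (use lip_spaceD[OF f] in auto)
    then show "linf_sum (lip_space K 0) (1 * L) (R f)" unfolding linf_sum_def R_def by simp
  qed (auto simp: R_def fun_eq_iff algebra_simps)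
  have "R (S g) = g" if g: "g \<in> vectors (linf_sum (lip_space K 0))" for g
  proof (intro ext)
    fix jx :: "nat \<times> 'a"
    obtain j x where jx: "jx = (j, x)" by fastforce
    have gj: "(\<lambda>x. g (j, x)) \<in> Lip0 K 0"
      using vectors_linf_sum_nth[OF g] unfolding vectors_lip_space .
    \<comment> \<open>On the \<open>j\<close>-th copy the cutoff is 1 and \<open>r\<close> is the
      identity, so the entry is recovered exactly.\<close>
    have Sp: "S g (p j x) = \<delta> / 2 ^ j * g (j, x)" if x: "x \<in> K" for x
    proof -
      have "norm (q j (p j x)) < 2 * D" using D(1) D(2)[OF x] by (simp add: qp)
      then have "J (p j x) = j" using near J by blast
      then show ?thesis using pK[OF x] r(3)[OF x] \<phi>_one[OF D(2)[OF x]] by (simp add: S_def F_def qp)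
    qed
    show "R (S g) jx = g jx"
      using Sp[of x] Sp[OF K(3)] gj \<delta>(1) by (auto simp: jx R_def Lip0_def)
  qed
  with R S show ?thesis
    unfolding complemented_def by (intro exI[of _ S] exI[of _ R]) simp
qed

theorem Lip0_isomorphic_retract:
  fixes K :: "'a::real_normed_vector set"
  assumes K: "convex K" "bounded K" "0 \<in> K" "K \<noteq> {0}" "closure (cone hull K) = UNIV"
    and ret: "lipschitz_retract K" and q: "q \<in> K"
  shows "Lip0_isomorphic (UNIV :: 'a set) p K q"
proof -
  obtain C r where r: "C-lipschitz_on UNIV r" "range r \<subseteq> K" "\<And>x. x \<in> K \<Longrightarrow> r x = x"
    using ret unfolding lipschitz_retract_def by blast
  let ?A = "lip_space (UNIV :: 'a set) 0" and ?B = "lip_space K 0"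
  have BA: "complemented ?B ?A"
    by (rule complemented_lip_space_retract[OF r K(3)])
  have AZ: "complemented ?A (linf_sum ?B)"
    by (rule complemented_lip_space_UNIV[OF r K(1,3,5)])
  have ZB: "complemented (linf_sum ?B) ?B"
    by (rule complemented_linf_sum_lip_space[OF r K(1-4)])
  have "isomorphic ?A (linf_sum ?B)"
    by (rule pelczynski_decomposition[OF normed_space_lip_space normed_space_lip_space complemented_trans[OF ZB BA] AZ])
  moreover have "isomorphic ?B (linf_sum ?B)"
    by (rule pelczynski_decomposition[OF normed_space_lip_space normed_space_lip_space ZB complemented_trans[OF BA AZ]])
  ultimately have "isomorphic ?A ?B"
    using isomorphic_trans isomorphic_sym by blast
  \<comment> \<open>Everything so far is based at 0, where dilations act; the base points are moved
    only now.\<close>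
  then have "isomorphic ?A (lip_space K q)"
    by (rule isomorphic_trans[OF _ isomorphic_lip_space_base[OF K(3) q]])
  then have "isomorphic (lip_space (UNIV :: 'a set) p) (lip_space K q)"
    by (rule isomorphic_trans[OF isomorphic_lip_space_base[OF UNIV_I UNIV_I]])
  then show ?thesis by (rule isomorphic_lip_space_imp)
qed

section \<open>Finite-dimensional decompositions\<close>

lemma closed_if_subsequences:
  fixes S :: "'a::metric_space set"
  assumes "\<And>f :: nat \<Rightarrow> 'a. range f \<subseteq> S \<Longrightarrow> bounded (range f) \<Longrightarrow>
      \<exists>l\<in>S. \<exists>s. strict_mono s \<and> (f \<circ> s) \<longlonglongrightarrow> l"
  shows "closed S"
  unfolding closed_sequential_limits
proof (intro allI impI, elim conjE)
  fix x l assume x: "\<forall>n. x n \<in> S" "x \<longlonglongrightarrow> l"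
  then obtain l' s where l': "l' \<in> S" "strict_mono s" "(x \<circ> s) \<longlonglongrightarrow> l'"
    using assms[of x] convergent_imp_bounded by blast
  then have "l' = l" using LIMSEQ_subseq_LIMSEQ[OF x(2)] LIMSEQ_unique by blast
  with l' show "l \<in> S" by simp
qed

text \<open>Bolzano-Weierstrass by induction on the spanning set. A new vector \<open>b\<close> has
  positive distance from the old span, which bounds its coefficients; first these and then the
  remainders are made convergent along subsequences.\<close>

lemma bounded_sequence_in_span:
  fixes B :: "'a::real_normed_vector set" and f :: "nat \<Rightarrow> 'a"
  assumes "finite B" "range f \<subseteq> span B" "bounded (range f)"
  shows "\<exists>l\<in>span B. \<exists>s. strict_mono s \<and> (f \<circ> s) \<longlonglongrightarrow> l"
  using assms
proof (induction B arbitrary: f rule: finite_induct)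
  case empty
  then have "f = (\<lambda>n. 0)" by auto
  then have "strict_mono (id :: nat \<Rightarrow> nat) \<and> (f \<circ> id) \<longlonglongrightarrow> 0"
    by (auto simp: strict_mono_def)
  then show ?case by auto
next
  case (insert b B)
  show ?case
  proof (cases "b \<in> span B")
    case True
    then have "span (insert b B) = span B" by (rule span_redundant)
    then show ?thesis using insert.IH[of f] insert.prems by simp
  next
    case False
    \<comment> \<open>Closedness of the smaller span comes from the induction hypothesis
      itself.\<close>
    have "closed (span B)"
      by (rule closed_if_subsequences) (rule insert.IH)
    then obtain \<delta> where \<delta>: "0 < \<delta>" "\<And>y. y \<in> span B \<Longrightarrow> \<delta> \<le> dist y b"
      using False closure_approachable[of b "span B"] by (auto simp: not_less)
    obtain M where M: "\<And>n. norm (f n) \<le> M"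
      using insert.prems(2) unfolding bounded_iff by blast
    have "\<forall>n. \<exists>k. f n - k *\<^sub>R b \<in> span B"
      using insert.prems(1) span_breakdown_eq by blast
    then obtain c where c: "\<And>n. f n - c n *\<^sub>R b \<in> span B" by metis
    have c_le: "\<bar>c n\<bar> * \<delta> \<le> M" for n
    proof (cases "c n = 0")
      case True
      then show ?thesis using order_trans[OF norm_ge_zero M[of n]] by simp
    next
      case False
      let ?y = "f n - c n *\<^sub>R b"
      have "\<delta> \<le> dist (- ((1 / c n) *\<^sub>R ?y)) b"
        by (intro \<delta>(2) span_neg span_scale c)
      also have "- ((1 / c n) *\<^sub>R ?y) - b = - ((1 / c n) *\<^sub>R f n)"
        using False by (simp add: algebra_simps)
      then have "dist (- ((1 / c n) *\<^sub>R ?y)) b = norm (f n) / \<bar>c n\<bar>"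
        by (simp add: dist_norm)
      finally show ?thesis using False M[of n] by (simp add: field_simps)
    qed
    then have "\<bar>c n\<bar> \<le> M / \<delta>" for n using \<delta>(1) by (simp add: field_simps)
    then have "bounded (range c)" unfolding bounded_iff by auto
    then obtain c0 s where s: "strict_mono s" "(c \<circ> s) \<longlonglongrightarrow> c0"
      using bounded_imp_convergent_subsequence by blast
    let ?y = "\<lambda>n. f (s n) - c (s n) *\<^sub>R b"
    have "norm (?y n) \<le> M + M / \<delta> * norm b" for n
    proof -
      have "norm (?y n) \<le> norm (f (s n)) + \<bar>c (s n)\<bar> * norm b"
        using norm_triangle_ineq4[of "f (s n)" "c (s n) *\<^sub>R b"] by simp
      also have "\<dots> \<le> M + M / \<delta> * norm b"
        using \<open>\<And>n. \<bar>c n\<bar> \<le> M / \<delta>\<close> M by (intro add_mono mult_right_mono) auto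
      finally show ?thesis .
    qed
    then have "bounded (range ?y)" unfolding bounded_iff by blast
    then obtain l t where l: "l \<in> span B" "strict_mono t" "(?y \<circ> t) \<longlonglongrightarrow> l"
      using insert.IH[of ?y] c by blast
    have "((c \<circ> s) \<circ> t) \<longlonglongrightarrow> c0" by (rule LIMSEQ_subseq_LIMSEQ[OF s(2) l(2)])
    then have "(\<lambda>n. (?y \<circ> t) n + ((c \<circ> s) \<circ> t) n *\<^sub>R b) \<longlonglongrightarrow> l + c0 *\<^sub>R b"
      by (intro tendsto_intros l(3))
    then have "(f \<circ> (s \<circ> t)) \<longlonglongrightarrow> l + c0 *\<^sub>R b" by (simp add: o_def)
    moreover have "l + c0 *\<^sub>R b \<in> span (insert b B)"
      using l(1) by (simp add: span_breakdown_eq[of _ b] exI[of _ c0])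
    moreover have "strict_mono (s \<circ> t)" using s(1) l(2) by (rule strict_mono_o)
    ultimately show ?thesis by blast
  qed
qed

lemma closed_span_finite:
  fixes B :: "'a::real_normed_vector set"
  assumes "finite B" shows "closed (span B)"
  by (rule closed_if_subsequences) (rule bounded_sequence_in_span[OF assms])

lemma compact_span_finite_Int_cball:
  fixes B :: "'a::real_normed_vector set"
  assumes "finite B" shows "compact (span B \<inter> cball 0 R)"
  unfolding compact_def
proof (intro allI impI)
  fix f :: "nat \<Rightarrow> 'a" assume f: "\<forall>n. f n \<in> span B \<inter> cball 0 R"
  then have "bounded (range f)" unfolding bounded_iff by auto
  then obtain l s where l: "l \<in> span B" "strict_mono s" "(f \<circ> s) \<longlonglongrightarrow> l"
    using bounded_sequence_in_span[OF assms, of f] f by blast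
  moreover have "l \<in> cball 0 R"
    by (rule closed_sequentially[OF closed_cball _ l(3)]) (use f in auto)
  ultimately show "\<exists>l\<in>span B \<inter> cball 0 R. \<exists>s. strict_mono s \<and> (f \<circ> s) \<longlonglongrightarrow> l" by blast
qed

section \<open>Radial retraction onto balls around the origin\<close>

definition trunc :: "real \<Rightarrow> 'a::real_normed_vector \<Rightarrow> 'a" where
  "trunc s u = (if norm u \<le> s then u else (s / norm u) *\<^sub>R u)"

lemma norm_trunc: "0 \<le> s \<Longrightarrow> norm (trunc s u) = min (norm u) s"
  by (auto simp: trunc_def)

text \<open>Changing the radius for a fixed vector costs \<open>\<bar>s - t\<bar>\<close>; for a
  fixed radius, radial retraction is 2-Lipschitz in any normed space.\<close>

lemma trunc_lipschitz:
  assumes "0 \<le> s" "0 \<le> t"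
  shows "norm (trunc s u - trunc t v) \<le> \<bar>s - t\<bar> + 2 * norm (u - v)"
proof -
  have rad: "norm (trunc s v - trunc t v) \<le> \<bar>s - t\<bar>"
  proof -
    have *: "trunc s v = (min (norm v) s / norm v) *\<^sub>R v" for s
      by (auto simp: trunc_def min_def)
    have "trunc s v - trunc t v = ((min (norm v) s - min (norm v) t) / norm v) *\<^sub>R v"
      unfolding *[of s] *[of t] by (simp add: diff_divide_distrib flip: scaleR_diff_left)
    then have "norm (trunc s v - trunc t v) \<le> \<bar>min (norm v) s - min (norm v) t\<bar>"
      by (cases "v = 0") auto
    then show ?thesis by linarith
  qed
  have one: "norm (trunc s u - trunc s v) \<le> 2 * norm (u - v)" if v: "norm v \<le> norm u" for u v :: 'a
  proof -
    have tri: "norm u - norm v \<le> norm (u - v)" by (rule norm_triangle_ineq2)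
    consider "norm u \<le> s" | "s < norm u" "norm v \<le> s" | "s < norm v" using v by linarith
    then show ?thesis
    proof cases
      case 1
      then show ?thesis using v by (simp add: trunc_def)
    next
      case 2
      have "trunc s u - trunc s v = (s / norm u - 1) *\<^sub>R u + (u - v)"
        using 2 by (simp add: trunc_def algebra_simps)
      then have "norm (trunc s u - trunc s v) \<le> \<bar>s / norm u - 1\<bar> * norm u + norm (u - v)"
        using norm_triangle_ineq[of "(s / norm u - 1) *\<^sub>R u" "u - v"] by simp
      also have "\<bar>s / norm u - 1\<bar> * norm u = norm u - s"
        using 2 assms(1) less_le_trans[of 0 "norm u"] by (auto simp: abs_if divide_simps)
      finally show ?thesis using 2 tri by linarith
    next
      case 3
      then have pos: "0 < norm v" "0 < norm u" using assms v by linarith+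
      \<comment> \<open>Both vectors are shortened: one term compares them under the same factor,
        the other corrects the two normalisations. Each is at most
        \<open>norm (u - v)\<close>.\<close>
      have "trunc s u - trunc s v = (s / norm u) *\<^sub>R (u - v) - (s * (norm u - norm v) / (norm u * norm v)) *\<^sub>R v"
      proof -
        have "s * (norm u - norm v) / (norm u * norm v) = s / norm v - s / norm u"
          using pos by (simp add: field_simps)
        then show ?thesis using 3 v by (simp add: trunc_def scaleR_diff_left scaleR_diff_right)
      qed
      then have "norm (trunc s u - trunc s v) \<le>
          s / norm u * norm (u - v) + s * (norm u - norm v) / (norm u * norm v) * norm v"
        using norm_triangle_ineq4[of "(s / norm u) *\<^sub>R (u - v)" "(s * (norm u - norm v) / (norm u * norm v)) *\<^sub>R v"]
          assms v by simp
      also have "s * (norm u - norm v) / (norm u * norm v) * norm v = s / norm u * (norm u - norm v)"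
        using pos by simp
      also have "s / norm u * norm (u - v) + \<dots> \<le> 1 * norm (u - v) + 1 * norm (u - v)"
        using 3 v pos tri assms by (intro add_mono mult_mono) auto
      finally show ?thesis by simp
    qed
  qed
  have "norm (trunc s u - trunc s v) \<le> 2 * norm (u - v)"
    using one[of v u] one[of u v] by (cases "norm v \<le> norm u") (auto simp: norm_minus_commute)
  then show ?thesis
    using rad norm_triangle_ineq[of "trunc s u - trunc s v" "trunc s v - trunc t v"] by simp
qed

section \<open>Coordinates and uniform boundedness of the partial sum projections\<close>

locale fdd =
  fixes E :: "nat \<Rightarrow> 'a::banach set"
  assumes fdd: "finite_dim_decomposition E"
begin

definition coord :: "'a \<Rightarrow> nat \<Rightarrow> 'a" where
  "coord x = (THE u. (\<forall>n. u n \<in> E n) \<and> u sums x)"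

definition proj :: "nat \<Rightarrow> 'a \<Rightarrow> 'a" where
  "proj n x = (\<Sum>k<n. coord x k)"

lemma subspace_E: "subspace (E n)"
  using fdd unfolding finite_dim_decomposition_def by blast

lemma coord: "coord x n \<in> E n" "coord x sums x"
proof -
  have "\<exists>!u. (\<forall>n. u n \<in> E n) \<and> u sums x"
    using fdd unfolding finite_dim_decomposition_def by blast
  from theI'[OF this] show "coord x n \<in> E n" "coord x sums x"
    unfolding coord_def by blast+
qed

text \<open>Coordinates are computed below by exhibiting an expansion and applying this
  uniqueness.\<close>

lemma coord_unique: "(\<And>n. v n \<in> E n) \<Longrightarrow> v sums x \<Longrightarrow> coord x = v"
  using fdd coord unfolding finite_dim_decomposition_def by metis

lemma coord_add: "coord (x + y) n = coord x n + coord y n"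
  by (rule fun_cong[OF coord_unique]) (intro subspace_add subspace_E coord sums_add)+

lemma coord_scaleR: "coord (c *\<^sub>R x) n = c *\<^sub>R coord x n"
  by (rule fun_cong[OF coord_unique]) (intro subspace_scale subspace_E coord sums_scaleR_right)+

lemma coord_diff: "coord (x - y) n = coord x n - coord y n"
  using coord_add[of x "-1 *\<^sub>R y" n] coord_scaleR[of "-1" y n] by simp

lemma coord_zero [simp]: "coord 0 n = 0"
  using coord_scaleR[of 0 0 n] by simp

lemma proj_scaleR: "proj n (c *\<^sub>R x) = c *\<^sub>R proj n x"
  and proj_diff: "proj n (x - y) = proj n x - proj n y"
  by (simp_all add: proj_def coord_scaleR coord_diff scaleR_sum_right sum_subtractf)

lemma proj_zero [simp]: "proj n 0 = 0"
  by (simp add: proj_def)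

lemma proj_tendsto: "(\<lambda>n. proj n x) \<longlonglongrightarrow> x"
  using coord(2) unfolding sums_def proj_def .

lemma coord_eq_proj_diff: "coord x k = proj (Suc k) x - proj k x"
  by (simp add: proj_def)

lemma coord_proj: "coord (proj n x) = (\<lambda>j. if j < n then coord x j else 0)"
proof (rule coord_unique)
  show "(if j < n then coord x j else 0) \<in> E j" for j
    using coord(1) subspace_0[OF subspace_E] by simp
  show "(\<lambda>j. if j < n then coord x j else 0) sums proj n x"
    using sums_If_finite_set[of "{..<n}" "coord x"] by (simp add: proj_def)
qed

lemma closed_E: "closed (E n)"
proof -
  obtain B where "finite B" "span B = E n"
    using fdd unfolding finite_dim_decomposition_def by blast
  then show ?thesis using closed_span_finite by metis
qed

text \<open>Baire category produces a ball in which the vectors with uniformly bounded partial sums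
  are dense.\<close>

lemma proj_bounded_approx:
  "\<exists>C\<ge>0. \<forall>y. \<exists>a. norm (y - a) \<le> norm y / 2 \<and> (\<forall>n. norm (proj n a) \<le> C * norm y)"
proof -
  define A where "A = (\<lambda>m. {x. \<forall>n. norm (proj n x) \<le> real m})"
  have UA: "(\<Union>m. closure (A m)) = UNIV"
  proof -
    have "\<exists>m. x \<in> A m" for x
    proof -
      obtain M where M: "\<And>n. norm (proj n x) \<le> M"
        using convergent_imp_bounded[OF proj_tendsto] unfolding bounded_iff by blast
      obtain m where "M \<le> real m" using real_arch_simple by blast
      then have "x \<in> A m" using M order_trans unfolding A_def by blast
      then show ?thesis ..
    qed
    then show ?thesis using closure_subset by blast
  qed
  have "\<exists>m. interior (closure (A m)) \<noteq> {}"
  proof (rule ccontr)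
    assume "\<not> ?thesis"
    then have int: "euclidean interior_of (closure (A m)) = {}" for m
      using interior_maximal[OF _ openin_interior_of[of euclidean "closure (A m)", unfolded open_openin[symmetric]]]
        interior_of_subset[of euclidean "closure (A m)"]
      by (metis interior_maximal open_openin openin_interior_of subset_empty)
    have "Met_TC.mtopology interior_of \<Union>(range (\<lambda>m. closure (A m))) = {}"
      by (rule Met_TC.metric_Baire_category_alt) (use int complete_UNIV in auto)
    then show False using UA by (simp add: interior_of_openin)
  qed
  then obtain m x0 where "x0 \<in> interior (closure (A m))" by blast
  then obtain \<rho> where \<rho>: "0 < \<rho>" "ball x0 \<rho> \<subseteq> closure (A m)"
    using mem_interior by blast
  \<comment> \<open>The ball is moved to the origin: half the difference of approximants to
    \<open>x0 + y\<close> and \<open>x0 - y\<close> approximates \<open>y\<close> and stays in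
    \<open>A m\<close>.\<close>
  have small: "\<exists>a\<in>A m. dist a y \<le> e" if y: "norm y < \<rho>" and e: "0 < e" for y e
  proof -
    have "x0 + y \<in> closure (A m)" "x0 - y \<in> closure (A m)"
      using \<rho>(2) y by (auto simp: dist_norm)
    then obtain a1 a2 where a: "a1 \<in> A m" "dist a1 (x0 + y) < e" "a2 \<in> A m" "dist a2 (x0 - y) < e"
      using closure_approachable e by metis
    let ?a = "(1/2) *\<^sub>R (a1 - a2)"
    have "norm (proj n ?a) \<le> real m" for n
    proof -
      have "norm (proj n a1) \<le> m" "norm (proj n a2) \<le> m" using a by (auto simp: A_def)
      then show ?thesis
        using norm_triangle_ineq4[of "proj n a1" "proj n a2"] by (simp add: proj_scaleR proj_diff)
    qed
    moreover have "dist ?a y \<le> e"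
    proof -
      have "?a - y = (1/2) *\<^sub>R ((a1 - (x0 + y)) - (a2 - (x0 - y)))"
        by (simp add: algebra_simps flip: scaleR_add_left)
      then have "norm (?a - y) \<le> (1/2) * (norm (a1 - (x0 + y)) + norm (a2 - (x0 - y)))"
        using norm_triangle_ineq4[of "a1 - (x0 + y)" "a2 - (x0 - y)"] by simp
      then show ?thesis using a by (simp add: dist_norm)
    qed
    ultimately show ?thesis unfolding A_def by blast
  qed
  have "\<exists>a. norm (y - a) \<le> norm y / 2 \<and> (\<forall>n. norm (proj n a) \<le> (2 * real m / \<rho>) * norm y)" for y
  proof (cases "y = 0")
    case True
    then show ?thesis by (intro exI[of _ 0]) simp
  next
    case False
    \<comment> \<open>Scales \<open>y\<close> to norm \<open>\<rho> / 2\<close>, safely inside the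
      ball; scaling back turns the bound \<open>m\<close> into \<open>2 * m / \<rho>\<close> times
      \<open>norm y\<close>.\<close>
    define t where "t = \<rho> / (2 * norm y)"
    have t: "0 < t" using False \<rho>(1) by (simp add: t_def)
    have "norm (t *\<^sub>R y) < \<rho>" using False \<rho>(1) by (simp add: t_def)
    then obtain a where a: "a \<in> A m" "dist a (t *\<^sub>R y) \<le> t * (norm y / 2)"
      using small[of "t *\<^sub>R y" "t * (norm y / 2)"] t False by auto
    have "norm (y - (1 / t) *\<^sub>R a) = norm ((1 / t) *\<^sub>R (t *\<^sub>R y - a))"
      using t by (simp add: scaleR_diff_right)
    also have "\<dots> = dist a (t *\<^sub>R y) / t"
      using t by (simp add: dist_norm norm_minus_commute)
    also have "\<dots> \<le> norm y / 2" using a(2) t by (simp add: divide_le_eq mult.commute)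
    finally have 1: "norm (y - (1 / t) *\<^sub>R a) \<le> norm y / 2" .
    have "norm (proj n ((1 / t) *\<^sub>R a)) \<le> (2 * real m / \<rho>) * norm y" for n
    proof -
      have "norm (proj n ((1 / t) *\<^sub>R a)) = norm (proj n a) / t"
        using t by (simp add: proj_scaleR)
      also have "\<dots> \<le> real m / t"
        using a(1) t by (intro divide_right_mono) (auto simp: A_def)
      finally show ?thesis using False by (simp add: t_def mult_ac)
    qed
    with 1 show ?thesis by blast
  qed
  moreover have "0 \<le> 2 * real m / \<rho>" using \<rho>(1) by simp
  ultimately show ?thesis by blast
qed

text \<open>Iterated approximation writes \<open>x\<close> as a series of vectors whose projections
  are geometrically bounded. Since projections cannot yet be applied termwise to a series, the
  termwise sums are shown to form an expansion of \<open>x\<close>, and uniqueness identifies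
  them.\<close>

lemma proj_uniformly_bounded: "\<exists>C\<ge>0. \<forall>n x. norm (proj n x) \<le> C * norm x"
proof -
  obtain C where C: "0 \<le> C" and ex: "\<And>y. \<exists>a. norm (y - a) \<le> norm y / 2 \<and> (\<forall>n. norm (proj n a) \<le> C * norm y)"
    using proj_bounded_approx by blast
  obtain h where h: "\<And>y. norm (y - h y) \<le> norm y / 2" "\<And>y n. norm (proj n (h y)) \<le> C * norm y"
    using ex by metis
  have "norm (proj n x) \<le> 2 * C * norm x" for n x
  proof -
    define y where "y = rec_nat x (\<lambda>_ z. z - h z)"
    have y: "y 0 = x" "\<And>k. y (Suc k) = y k - h (y k)" by (simp_all add: y_def)
    define a where "a = (\<lambda>k. h (y k))"
    have y_norm: "norm (y k) \<le> norm x * (1/2) ^ k" for k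
    proof (induction k)
      case (Suc k)
      then show ?case using h(1)[of "y k"] by (simp add: y)
    qed (simp add: y)
    have "(\<Sum>k<N. a k) = x - y N" for N
      by (induction N) (simp_all add: y a_def)
    moreover have "y \<longlonglongrightarrow> 0"
    proof (rule Lim_null_comparison)
      show "\<forall>\<^sub>F k in sequentially. norm (y k) \<le> norm x * (1/2) ^ k" using y_norm by simp
      show "(\<lambda>k. norm x * (1/2) ^ k) \<longlonglongrightarrow> 0" by (intro tendsto_mult_right_zero LIMSEQ_realpow_zero) auto
    qed
    then have "(\<lambda>N. x - y N) \<longlonglongrightarrow> x - 0" by (intro tendsto_intros)
    ultimately have a_sums: "(\<lambda>N. \<Sum>k<N. a k) \<longlonglongrightarrow> x" by simp
    define M where "M = (\<lambda>k. C * norm x * (1/2) ^ k)"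
    have M_sums: "M sums (2 * C * norm x)"
      using sums_mult[OF geometric_sums[of "1/2 :: real"], of "C * norm x"] by (simp add: M_def mult_ac)
    have pa: "norm (proj n (a k)) \<le> M k" for n k
      using order_trans[OF h(2)[of n "y k"] mult_left_mono[OF y_norm C]] by (simp add: a_def M_def mult_ac)
    have pa_summable: "summable (\<lambda>k. proj n (a k))" for n
      by (rule summable_comparison_test'[OF sums_summable[OF M_sums]]) (rule pa)
    \<comment> \<open>Uniformity in \<open>n\<close> is what permits exchanging the limit of the
      partial sums with the limit of the projections.\<close>
    have unif: "uniform_limit UNIV (\<lambda>N n. \<Sum>k<N. proj n (a k)) (\<lambda>n. \<Sum>k. proj n (a k)) sequentially"
      by (rule Weierstrass_m_test[OF pa sums_summable[OF M_sums]])
    have lim: "(\<lambda>n. \<Sum>k. proj n (a k)) \<longlonglongrightarrow> x"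
      by (rule swap_uniform_limit'[OF _ a_sums unif])
        (auto intro!: always_eventually tendsto_sum proj_tendsto)
    define v where "v = (\<lambda>j. \<Sum>k. coord (a k) j)"
    have coord_summable: "summable (\<lambda>k. coord (a k) j)" for j
      unfolding coord_eq_proj_diff by (intro summable_diff pa_summable)
    have v_sum: "(\<Sum>j<n. v j) = (\<Sum>k. proj n (a k))" for n
      unfolding v_def proj_def by (rule suminf_sum[symmetric]) (rule coord_summable)
    have "coord x = v"
    proof (rule coord_unique)
      show "v j \<in> E j" for j
      \<comment> \<open>Finite-dimensionality enters here: \<open>E j\<close> is closed, so it
        contains the infinite sum.\<close>
      proof (rule closed_sequentially[OF closed_E])
        show "(\<lambda>N. \<Sum>k<N. coord (a k) j) \<longlonglongrightarrow> v j"
          using summable_LIMSEQ[OF coord_summable] unfolding v_def .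
        show "(\<Sum>k<N. coord (a k) j) \<in> E j" for N
          by (intro subspace_sum subspace_E coord(1))
      qed
      show "v sums x" unfolding sums_def v_sum by (rule lim)
    qed
    then have "norm (proj n x) = norm (\<Sum>k. proj n (a k))"
      using v_sum by (simp add: proj_def)
    also have "\<dots> \<le> (\<Sum>k. M k)"
      by (intro norm_suminf_le pa sums_summable[OF M_sums])
    also have "\<dots> = 2 * C * norm x" using M_sums by (rule sums_unique[symmetric])
    finally show ?thesis .
  qed
  then show ?thesis using C by (intro exI[of _ "2 * C"]) auto
qed

section \<open>The compact convex set and its linear density\<close>

definition K :: "'a set" where
  "K = {x. \<forall>n. (\<Sum>k<n. 2 ^ k * norm (coord x k)) \<le> 1}"

lemma K_I: "(\<And>n. (\<Sum>k<n. 2 ^ k * norm (coord x k)) \<le> 1) \<Longrightarrow> x \<in> K"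
  and K_D: "x \<in> K \<Longrightarrow> (\<Sum>k<n. 2 ^ k * norm (coord x k)) \<le> 1"
  by (auto simp: K_def)

lemma zero_in_K: "0 \<in> K"
  by (simp add: K_def)

lemma convex_K: "convex K"
proof (rule convexI)
  fix x y and s t :: real
  assume x: "x \<in> K" and y: "y \<in> K" and st: "0 \<le> s" "0 \<le> t" "s + t = 1"
  show "s *\<^sub>R x + t *\<^sub>R y \<in> K"
  proof (rule K_I)
    fix n
    have "(\<Sum>k<n. 2 ^ k * norm (coord (s *\<^sub>R x + t *\<^sub>R y) k))
        \<le> (\<Sum>k<n. s * (2 ^ k * norm (coord x k)) + t * (2 ^ k * norm (coord y k)))"
    proof (rule sum_mono)
      fix k
      have "norm (coord (s *\<^sub>R x + t *\<^sub>R y) k) \<le> s * norm (coord x k) + t * norm (coord y k)"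
        using norm_triangle_ineq[of "s *\<^sub>R coord x k" "t *\<^sub>R coord y k"] st
        by (simp add: coord_add coord_scaleR)
      then have "2 ^ k * norm (coord (s *\<^sub>R x + t *\<^sub>R y) k)
          \<le> 2 ^ k * (s * norm (coord x k) + t * norm (coord y k))"
        by (rule mult_left_mono) simp
      then show "2 ^ k * norm (coord (s *\<^sub>R x + t *\<^sub>R y) k)
          \<le> s * (2 ^ k * norm (coord x k)) + t * (2 ^ k * norm (coord y k))"
        by (simp add: algebra_simps)
    qed
    also have "\<dots> = s * (\<Sum>k<n. 2 ^ k * norm (coord x k)) + t * (\<Sum>k<n. 2 ^ k * norm (coord y k))"
      by (simp add: sum.distrib sum_distrib_left)
    also have "\<dots> \<le> s * 1 + t * 1"
      by (intro add_mono mult_left_mono K_D x y st)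
    finally show "(\<Sum>k<n. 2 ^ k * norm (coord (s *\<^sub>R x + t *\<^sub>R y) k)) \<le> 1" using st by simp
  qed
qed

text \<open>From index \<open>n\<close> on all weights are at least \<open>2 ^ n\<close>, and the
  weighted sum is at most 1. The bound is uniform over \<open>K\<close>.\<close>

lemma K_tail:
  assumes "x \<in> K" shows "dist x (proj n x) \<le> 1 / 2 ^ n"
proof -
  have "norm (proj m x - proj n x) \<le> 1 / 2 ^ n" if "n \<le> m" for m
  proof -
    have "proj m x - proj n x = (\<Sum>k\<in>{n..<m}. coord x k)"
      using sum_diff_nat_ivl[of 0 n m "coord x"] that by (simp add: proj_def lessThan_atLeast0)
    also have "norm \<dots> \<le> (\<Sum>k\<in>{n..<m}. norm (coord x k))" by (rule norm_sum)
    also have "\<dots> \<le> (\<Sum>k\<in>{n..<m}. 2 ^ k * norm (coord x k) / 2 ^ n)"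
    proof (rule sum_mono)
      fix k assume "k \<in> {n..<m}"
      then have "(2::real) ^ n \<le> 2 ^ k" by (intro power_increasing) auto
      then have "2 ^ n * norm (coord x k) \<le> 2 ^ k * norm (coord x k)"
        by (intro mult_right_mono) auto
      then show "norm (coord x k) \<le> 2 ^ k * norm (coord x k) / 2 ^ n"
        by (simp add: le_divide_eq mult.commute)
    qed
    also have "\<dots> \<le> (\<Sum>k<m. 2 ^ k * norm (coord x k) / 2 ^ n)"
      by (rule sum_mono2) auto
    also have "\<dots> \<le> 1 / 2 ^ n"
      using K_D[OF assms, of m] by (simp add: divide_right_mono flip: sum_divide_distrib)
    finally show ?thesis .
  qed
  then have "eventually (\<lambda>m. norm (proj m x - proj n x) \<le> 1 / 2 ^ n) sequentially"
    unfolding eventually_sequentially by blast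
  moreover have "(\<lambda>m. norm (proj m x - proj n x)) \<longlonglongrightarrow> norm (x - proj n x)"
    by (intro tendsto_intros proj_tendsto)
  ultimately have "norm (x - proj n x) \<le> 1 / 2 ^ n"
    by (intro tendsto_upperbound) auto
  then show ?thesis by (simp add: dist_norm)
qed

lemma bounded_K: "bounded K"
proof -
  have "norm x \<le> 1" if "x \<in> K" for x
    using K_tail[OF that, of 0] by (simp add: proj_def)
  then show ?thesis unfolding bounded_iff by blast
qed

lemma bounded_linear_coord: "bounded_linear (\<lambda>x. coord x k)"
proof -
  obtain C where C: "0 \<le> C" "\<And>n x. norm (proj n x) \<le> C * norm x"
    using proj_uniformly_bounded by blast
  show ?thesis
  proof (rule bounded_linear_intro[where K = "2 * C"])
    show "norm (coord x k) \<le> norm x * (2 * C)" for x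
      using norm_triangle_ineq4[of "proj (Suc k) x" "proj k x"] C(2)[of "Suc k" x] C(2)[of k x]
      unfolding coord_eq_proj_diff by (simp add: algebra_simps)
  qed (simp_all add: coord_add coord_scaleR)
qed

text \<open>Phrasing \<open>K\<close> through finite sums makes it an intersection of sublevel sets
  of continuous functions.\<close>

lemma closed_K: "closed K"
proof -
  have "K = (\<Inter>n. {x. (\<Sum>k<n. 2 ^ k * norm (coord x k)) \<le> 1})"
    by (auto simp: K_def)
  moreover have "closed {x. (\<Sum>k<n. 2 ^ k * norm (coord x k)) \<le> 1}" for n
    by (intro closed_Collect_le continuous_intros
        bounded_linear.continuous_on[OF bounded_linear_coord])
  ultimately show ?thesis by auto
qed

text \<open>By \<open>K_tail\<close>, a projection of large index moves points of \<open>K\<close>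
  by less than \<open>e / 2\<close> into a compact finite-dimensional set; an
  \<open>e / 2\<close>-net there is an \<open>e\<close>-net for \<open>K\<close>.\<close>

lemma compact_K: "compact K"
  unfolding compact_eq_totally_bounded
proof (intro conjI allI impI)
  show "complete K" using closed_K by (simp add: complete_eq_closed)
  fix e :: real assume e: "0 < e"
  obtain n where n: "1 / 2 ^ n < e / 2"
    using real_arch_pow_inv[of "e / 2" "1 / 2"] e by (auto simp: power_one_over)
  obtain C where C: "\<And>x. norm (proj n x) \<le> C * norm x" "0 \<le> C"
    using proj_uniformly_bounded by blast
  obtain M where M: "\<And>x. x \<in> K \<Longrightarrow> norm x \<le> M" using bounded_K unfolding bounded_iff by blast
  have "\<forall>k. \<exists>B. finite B \<and> span B = E k"
    using fdd unfolding finite_dim_decomposition_def by blast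
  then obtain B where B: "\<And>k. finite (B k)" "\<And>k. span (B k) = E k" by metis
  let ?T = "span (\<Union>k<n. B k) \<inter> cball 0 (C * M)"
  have "compact ?T" by (rule compact_span_finite_Int_cball) (use B in auto)
  then obtain F where F: "finite F" "?T \<subseteq> (\<Union>x\<in>F. ball x (e / 2))"
    unfolding compact_eq_totally_bounded using e half_gt_zero by metis
  have "K \<subseteq> (\<Union>x\<in>F. ball x e)"
  proof
    fix x assume x: "x \<in> K"
    have "coord x k \<in> span (\<Union>k<n. B k)" if "k < n" for k
      using coord(1)[of x k] span_mono[of "B k" "\<Union>k<n. B k"] that B(2) by blast
    then have "proj n x \<in> span (\<Union>k<n. B k)"
      unfolding proj_def by (intro span_sum) auto
    moreover have "norm (proj n x) \<le> C * M"
      using C(1)[of x] mult_left_mono[OF M[OF x] C(2)] by linarith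
    ultimately obtain y where y: "y \<in> F" "dist y (proj n x) < e / 2" using F(2) by auto
    then have "dist y x < e"
      using dist_triangle[of y x "proj n x"] K_tail[OF x, of n] n by (simp add: dist_commute)
    with y(1) show "x \<in> (\<Union>x\<in>F. ball x e)" by auto
  qed
  with F(1) show "\<exists>F. finite F \<and> K \<subseteq> (\<Union>x\<in>F. ball x e)" by blast
qed

lemma proj_in_cone_hull_K: "proj n x \<in> cone hull K"
proof -
  \<comment> \<open>\<open>M - 1\<close> is the weighted sum of \<open>proj n x\<close>, so division
    by \<open>M\<close> lands in \<open>K\<close>; the summand 1 keeps \<open>M\<close> positive
    even when the projection is 0.\<close>
  define M where "M = 1 + (\<Sum>k<n. 2 ^ k * norm (coord x k))"
  have M: "1 \<le> M" by (simp add: M_def sum_nonneg)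
  have "(1 / M) *\<^sub>R proj n x \<in> K"
  proof (rule K_I)
    fix m
    have "(\<Sum>k<m. 2 ^ k * norm (coord ((1 / M) *\<^sub>R proj n x) k))
        = (\<Sum>k<m. if k < n then 2 ^ k * norm (coord x k) / M else 0)"
      using M by (intro sum.cong) (auto simp: coord_scaleR coord_proj)
    also have "\<dots> = (\<Sum>k\<in>{..<m} \<inter> {..<n}. 2 ^ k * norm (coord x k) / M)"
      by (simp add: sum.inter_restrict)
    also have "\<dots> \<le> (\<Sum>k<n. 2 ^ k * norm (coord x k) / M)"
      using M by (intro sum_mono2) auto
    also have "\<dots> = (M - 1) / M" by (simp add: M_def flip: sum_divide_distrib)
    also have "\<dots> \<le> 1" using M by (simp add: divide_le_eq)
    finally show "(\<Sum>k<m. 2 ^ k * norm (coord ((1 / M) *\<^sub>R proj n x) k)) \<le> 1" .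
  qed
  then have "M *\<^sub>R ((1 / M) *\<^sub>R proj n x) \<in> cone hull K"
    unfolding cone_hull_expl using M by fastforce
  then show ?thesis using M by simp
qed

lemma closure_cone_hull_K: "closure (cone hull K) = UNIV"
proof -
  have "x \<in> closure (cone hull K)" for x
    unfolding closure_sequential
    by (intro exI[of _ "\<lambda>n. proj n x"] conjI allI proj_in_cone_hull_K proj_tendsto)
  then show ?thesis by blast
qed

lemma linearly_dense_K: "linearly_dense K"
proof -
  have "cone hull K \<subseteq> span K"
    unfolding cone_hull_expl by (auto intro: span_scale span_base)
  then show ?thesis
    unfolding linearly_dense_def using closure_mono closure_cone_hull_K by blast
qed

lemma K_nontrivial: "K \<noteq> {0}"
proof
  assume K: "K = {0}"
  have "cone hull K = {0}" unfolding K cone_hull_expl by auto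
  then have "(UNIV :: 'a set) = {0}" using closure_cone_hull_K by simp
  moreover have "E 0 \<noteq> {0}" "0 \<in> E 0"
    using fdd subspace_0[OF subspace_E] unfolding finite_dim_decomposition_def by auto
  ultimately show False by blast
qed

section \<open>The Lipschitz retraction\<close>

primrec budget :: "'a \<Rightarrow> nat \<Rightarrow> real" where
  "budget x 0 = 1"
| "budget x (Suc k) = max 0 (budget x k - 2 ^ k * norm (coord x k))"

text \<open>The radius \<open>budget x k / 2 ^ k\<close> is the largest norm whose weighted cost the
  remaining budget can still pay.\<close>

definition clip :: "'a \<Rightarrow> nat \<Rightarrow> 'a" where
  "clip x k = trunc (budget x k / 2 ^ k) (coord x k)"

definition retr :: "'a \<Rightarrow> 'a" where
  "retr x = (\<Sum>k. clip x k)"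

lemma budget_nonneg: "0 \<le> budget x k"
  by (cases k) auto

lemma budget_antimono: "j \<le> k \<Longrightarrow> budget x k \<le> budget x j"
proof (induction rule: dec_induct)
  case (step n)
  have "budget x (Suc n) \<le> budget x n" using budget_nonneg[of x n] by simp
  with step show ?case by linarith
qed simp

text \<open>The weighted norm of each clipped component is exactly the budget it uses up, so the
  weighted sums of \<open>retr x\<close> telescope.\<close>

lemma norm_clip: "2 ^ k * norm (clip x k) = budget x k - budget x (Suc k)"
proof -
  have "2 ^ k * norm (clip x k) = 2 ^ k * min (norm (coord x k)) (budget x k / 2 ^ k)"
    by (simp add: clip_def norm_trunc budget_nonneg)
  also have "\<dots> = min (2 ^ k * norm (coord x k)) (budget x k)"
    by (auto simp: min_def field_simps)
  also have "\<dots> = budget x k - budget x (Suc k)"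
    using budget_nonneg[of x k] by auto
  finally show ?thesis .
qed

lemma norm_clip_le: "norm (clip x k) \<le> budget x k / 2 ^ k"
  by (simp add: clip_def norm_trunc budget_nonneg)

lemma clip_eq_coord: "2 ^ k * norm (coord x k) \<le> budget x k \<Longrightarrow> clip x k = coord x k"
  by (simp add: clip_def trunc_def le_divide_eq mult.commute)

lemma clip_eq_zero: "budget x k = 0 \<Longrightarrow> clip x k = 0"
  using norm_clip_le[of x k] by simp

lemma clip_sums: "clip x sums retr x"
proof -
  have "norm (clip x k) \<le> (1/2) ^ k" for k
    using norm_clip_le[of x k] divide_right_mono[OF budget_antimono[of 0 k x], of "2 ^ k"]
    by (simp add: power_one_over)
  then have "summable (clip x)"
    by (intro summable_comparison_test'[OF summable_geometric[of "1/2 :: real"]]) auto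
  then show ?thesis unfolding retr_def by (rule summable_sums)
qed

lemma coord_retr: "coord (retr x) = clip x"
proof (rule coord_unique)
  show "clip x k \<in> E k" for k
    unfolding clip_def trunc_def using coord(1) subspace_scale[OF subspace_E] by auto
qed (rule clip_sums)

lemma retr_in_K: "retr x \<in> K"
proof (rule K_I)
  fix n
  have "(\<Sum>k<n. 2 ^ k * norm (coord (retr x) k)) = 1 - budget x n"
    unfolding coord_retr by (induction n) (simp_all add: norm_clip del: budget.simps(2))
  then show "(\<Sum>k<n. 2 ^ k * norm (coord (retr x) k)) \<le> 1"
    using budget_nonneg[of x n] by simp
qed

lemma retr_eq_self:
  assumes "\<And>k. 2 ^ k * norm (coord x k) \<le> budget x k"
  shows "retr x = x"
proof -
  have "clip x = coord x" using assms clip_eq_coord by blast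
  then show ?thesis using clip_sums[of x] coord(2)[of x] sums_unique2 by metis
qed

lemma retr_K:
  assumes "x \<in> K" shows "retr x = x"
proof (rule retr_eq_self)
  \<comment> \<open>On \<open>K\<close> the cut-off at 0 in \<open>budget\<close> never takes
    effect.\<close>
  have b: "budget x n = 1 - (\<Sum>k<n. 2 ^ k * norm (coord x k))" for n
  proof (induction n)
    case (Suc n)
    then show ?case using K_D[OF assms, of "Suc n"] by simp
  qed simp
  show "2 ^ k * norm (coord x k) \<le> budget x k" for k
    using K_D[OF assms, of "Suc k"] by (simp add: b)
qed

text \<open>The expansions are compared around the first index \<open>N\<close> where one of the two
  points overspends. Before \<open>N\<close> the difference is a partial sum projection; at
  \<open>N\<close> truncation is controlled; after \<open>N\<close> one point has no budget left and
  the other only a little.\<close>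

lemma retr_lipschitz: "\<exists>L. L-lipschitz_on UNIV retr"
proof -
  obtain C where C: "0 \<le> C" "\<And>n x. norm (proj n x) \<le> C * norm x"
    using proj_uniformly_bounded by blast
  \<comment> \<open>Twice \<open>C\<close> bounds the coordinates, being differences of two
    projections, and the projections as well.\<close>
  define c where "c = 2 * C"
  have c: "0 \<le> c" using C(1) by (simp add: c_def)
  have proj_le: "norm (proj n x - proj n y) \<le> c * norm (x - y)" for n x y
    using C(2)[of n "x - y"] mult_nonneg_nonneg[OF C(1) norm_ge_zero[of "x - y"]]
    by (simp add: proj_diff c_def)
  have coord_le: "norm (coord x k - coord y k) \<le> c * norm (x - y)" for k x y
    using norm_triangle_ineq4[of "proj (Suc k) (x - y)" "proj k (x - y)"]
      C(2)[of "Suc k" "x - y"] C(2)[of k "x - y"]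
    unfolding coord_diff[symmetric] unfolding coord_eq_proj_diff c_def by simp
  \<comment> \<open>The error doubles at each step because the weights of all earlier components add
    up to less than \<open>2 ^ k\<close>.\<close>
  have budget_le: "\<bar>budget x k - budget y k\<bar> \<le> 2 ^ k * (c * norm (x - y))" for x y k
  proof (induction k)
    case 0
    then show ?case using c by simp
  next
    case (Suc k)
    have "\<bar>norm (coord x k) - norm (coord y k)\<bar> \<le> c * norm (x - y)"
      using norm_triangle_ineq3[of "coord x k" "coord y k"] coord_le[of x k y] by linarith
    then have "2 ^ k * \<bar>norm (coord x k) - norm (coord y k)\<bar> \<le> 2 ^ k * (c * norm (x - y))"
      by (rule mult_left_mono) simp
    then have "\<bar>2 ^ k * norm (coord x k) - 2 ^ k * norm (coord y k)\<bar> \<le> 2 ^ k * (c * norm (x - y))"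
      by (simp add: abs_mult flip: right_diff_distrib)
    moreover have "\<bar>budget x (Suc k) - budget y (Suc k)\<bar> \<le> \<bar>budget x k - budget y k\<bar>
        + \<bar>2 ^ k * norm (coord x k) - 2 ^ k * norm (coord y k)\<bar>"
      by simp
    moreover have "2 ^ Suc k * (c * norm (x - y)) = 2 ^ k * (c * norm (x - y)) + 2 ^ k * (c * norm (x - y))"
      by simp
    ultimately show ?case using Suc.IH by linarith
  qed
  \<comment> \<open>Here \<open>x\<close> is the point that overspends at \<open>N\<close>. The
    factor 6 is 1 for the terms before \<open>N\<close>, 3 for the term at \<open>N\<close> and 2
    for the tail.\<close>
  have stop: "norm (retr x - retr y) \<le> 6 * c * norm (x - y)"
    if N: "budget x N < 2 ^ N * norm (coord x N)"
      and x: "\<And>k. k < N \<Longrightarrow> 2 ^ k * norm (coord x k) \<le> budget x k"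
      and y: "\<And>k. k < N \<Longrightarrow> 2 ^ k * norm (coord y k) \<le> budget y k" for x y N
  proof -
    let ?d = "c * norm (x - y)"
    let ?f = "\<lambda>k. clip x k - clip y k"
    have f: "?f sums (retr x - retr y)"
      by (intro sums_diff clip_sums)
    have "(\<Sum>k<N. ?f k) = proj N x - proj N y"
      using x y by (simp add: proj_def clip_eq_coord sum_subtractf)
    then have head: "norm (\<Sum>k<N. ?f k) \<le> ?d" using proj_le by simp
    have "norm (?f N) \<le> \<bar>budget x N / 2 ^ N - budget y N / 2 ^ N\<bar> + 2 * norm (coord x N - coord y N)"
      unfolding clip_def by (intro trunc_lipschitz) (simp_all add: budget_nonneg)
    also have "\<bar>budget x N / 2 ^ N - budget y N / 2 ^ N\<bar> = \<bar>budget x N - budget y N\<bar> / 2 ^ N"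
      by (simp flip: diff_divide_distrib)
    also have "\<dots> \<le> ?d" using budget_le[of x N y] by (simp add: divide_le_eq mult.commute)
    finally have middle: "norm (?f N) \<le> 3 * ?d" using coord_le[of x N y] by simp
    have bN: "budget x (Suc N) = 0" using N by simp
    \<comment> \<open>What is left for \<open>y\<close> is at most \<open>2 ^ Suc N * ?d\<close>,
      and the weight at \<open>k + Suc N\<close> divides this by a further
      \<open>2 ^ k\<close>.\<close>
    have term_le: "norm (?f (k + Suc N)) \<le> ?d * (1/2) ^ k" for k
    proof -
      have "budget x (k + Suc N) = 0"
        using budget_antimono[of "Suc N" "k + Suc N" x] bN budget_nonneg[of x "k + Suc N"] by linarith
      then have "norm (?f (k + Suc N)) = norm (clip y (k + Suc N))"
        using clip_eq_zero by simp
      also have "\<dots> \<le> budget y (k + Suc N) / 2 ^ (k + Suc N)" by (rule norm_clip_le)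
      also have "\<dots> \<le> (2 ^ Suc N * ?d) / 2 ^ (k + Suc N)"
        using budget_antimono[of "Suc N" "k + Suc N" y] budget_le[of x "Suc N" y] bN
        by (intro divide_right_mono) (simp_all del: budget.simps(2))
      also have "\<dots> = ?d * (1/2) ^ k" by (simp add: power_add power_one_over)
      finally show ?thesis .
    qed
    have geom: "(\<lambda>k. ?d * (1/2) ^ k) sums (?d * 2)"
      using sums_mult[OF geometric_sums[of "1/2 :: real"], of ?d] by simp
    have "norm (\<Sum>k. ?f (k + Suc N)) \<le> (\<Sum>k. ?d * (1/2) ^ k)"
      by (intro norm_suminf_le term_le sums_summable[OF geom])
    then have tail: "norm (\<Sum>k. ?f (k + Suc N)) \<le> 2 * ?d"
      using sums_unique[OF geom] by simp
    have "retr x - retr y = (\<Sum>k. ?f (k + Suc N)) + (\<Sum>k<Suc N. ?f k)"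
      using suminf_split_initial_segment[OF sums_summable[OF f], of "Suc N"] sums_unique[OF f] by simp
    then have split: "retr x - retr y = (\<Sum>k. ?f (k + Suc N)) + ((\<Sum>k<N. ?f k) + ?f N)" by simp
    have "norm (a + (b + c)) \<le> 6 * e" if "norm a \<le> 2 * e" "norm b \<le> e" "norm c \<le> 3 * e"
      for a b c :: 'a and e
      using that norm_triangle_ineq[of a "b + c"] norm_triangle_ineq[of b c] by linarith
    from this[OF tail head middle] show ?thesis
      unfolding split by (simp only: mult.assoc)
  qed
  let ?over = "\<lambda>x k. budget x k < 2 ^ k * norm (coord x k)"
  \<comment> \<open>The summand 1 serves the case in which neither point overspends and
    \<open>retr\<close> fixes both.\<close>
  have "norm (retr x - retr y) \<le> (1 + 6 * c) * norm (x - y)" for x y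
  proof (cases "\<exists>k. ?over x k \<or> ?over y k")
    case False
    then have "retr x = x" "retr y = y" by (auto intro!: retr_eq_self simp: not_less)
    then show ?thesis using c by (simp add: distrib_right)
  next
    case True
    define N where "N = (LEAST k. ?over x k \<or> ?over y k)"
    have N: "?over x N \<or> ?over y N"
      unfolding N_def using True by (rule LeastI_ex)
    have less: "2 ^ k * norm (coord x k) \<le> budget x k" "2 ^ k * norm (coord y k) \<le> budget y k" if "k < N" for k
      using not_less_Least[OF that[unfolded N_def]] by (auto simp: not_less)
    have "norm (retr x - retr y) \<le> 6 * c * norm (x - y)"
      using N
    proof
      assume "?over x N"
      then show ?thesis by (rule stop) (use less in auto)
    next
      assume "?over y N"
      then have "norm (retr y - retr x) \<le> 6 * c * norm (y - x)"
        by (rule stop) (use less in auto)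
      then show ?thesis by (simp add: norm_minus_commute)
    qed
    then show ?thesis using norm_ge_zero[of "x - y"] unfolding distrib_right by linarith
  qed
  then have "(1 + 6 * c)-lipschitz_on UNIV retr"
    using c by (intro lipschitz_onI) (simp_all add: dist_norm)
  then show ?thesis ..
qed

lemma lipschitz_retract_K: "lipschitz_retract K"
  unfolding lipschitz_retract_def using retr_lipschitz retr_in_K retr_K by blast

end

theorem theorem3p12:
  assumes "\<exists>E :: nat \<Rightarrow> 'a::banach set. finite_dim_decomposition E"
  shows "\<exists>K :: 'a set. compact K \<and> convex K \<and> linearly_dense K \<and> lipschitz_retract K \<and>
           (\<forall>p. \<forall>q\<in>K. Lip0_isomorphic (UNIV :: 'a set) p K q)"
proof -
  obtain E :: "nat \<Rightarrow> 'a set" where "finite_dim_decomposition E"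
    using assms by blast
  then interpret fdd E by unfold_locales
  have "Lip0_isomorphic (UNIV :: 'a set) p K q" if "q \<in> K" for p q
    by (rule Lip0_isomorphic_retract[OF convex_K bounded_K zero_in_K K_nontrivial
          closure_cone_hull_K lipschitz_retract_K that])
  then show ?thesis
    using compact_K convex_K linearly_dense_K lipschitz_retract_K by blast
qed

end
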